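(* Let $p$ be a prime number, let $i,j\in\mathbb{Z}$, and let $C^{(p;i,j)}$ be the hyperelliptic curve over $\mathbb{Q}$ defined by \[y^2=x(x^2+2^ip^{j})(x^2+2^{i+1}p^{j}).\] Then: \begin{enumerate} \item For all $p$, we have $C^{(p;0,2)}(\mathbb{Q})=\{(0,0),\infty\}$. \item If $p\equiv 3 \pmod 4$, then \[C^{(p;2,2)}(\mathbb{Q})=\begin{cases}\{(0,0),(6,\pm 216),\infty\} & (p=3),\\ \{(0,0),\infty\} & (p\neq 3).\end{cases}\] \item If $p\equiv 13 \pmod{16}$, then $C^{(p;2,1)}(\mathbb{Q})=\{(0,0),\infty\}$. \item If $p\equiv 5 \pmod{16}$, then $C^{(p;2,3)}(\mathbb{Q})=\{(0,0),\infty\}$. \end{enumerate}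
   Context: The right-hand side is a polynomial of degree $5$ in $x$, so $C^{(p;i,j)}$ is a genus-$2$ hyperelliptic curve with a single rational point at infinity, denoted $\infty$; $C^{(p;i,j)}(\mathbb{Q})$ denotes the set of rational points of (the smooth projective model of) this curve, consisting of $\infty$ and the affine rational solutions $(x,y)$. *)

theory Defs
  imports Complex_Main "HOL-Computational_Algebra.Primes" "HOL-Number_Theory.Cong"
begin

definition C_rhs :: "nat \<Rightarrow> int \<Rightarrow> int \<Rightarrow> rat \<Rightarrow> rat" where
  "C_rhs p i j x =
     x * (x ^ 2 + 2 powi i * of_nat p powi j) * (x ^ 2 + 2 powi (i + 1) * of_nat p powi j)"

text \<open>
  For \<open>p \<noteq> 0\<close>, \<open>C_rhs p i j\<close> is a squarefree polynomial of odd degree 5. The affine curve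
  \<open>y\<^sup>2 = C_rhs p i j x\<close> is therefore smooth, and its smooth projective model has exactly one
  further point, which is rational. It is represented by \<open>Infinity\<close>.
\<close>

datatype 'a curve_point = Affine 'a 'a | Infinity

definition C_rational_points :: "nat \<Rightarrow> int \<Rightarrow> int \<Rightarrow> rat curve_point set" where
  "C_rational_points p i j = {Affine x y | x y. y ^ 2 = C_rhs p i j x} \<union> {Infinity}"

end

theory Submission
  imports Defs "HOL-Computational_Algebra.Nth_Powers"
begin

text \<open>
  A point with \<open>x \<noteq> 0\<close> has \<open>x > 0\<close>. Writing \<open>x\<close> (up to a scaling by \<open>p\<close> or \<open>2p\<close>) as \<open>r/s\<close> in
  lowest terms and clearing denominators makes the product of \<open>r\<close>, \<open>s\<close> and two quadratic forms
  in \<open>r, s\<close> a square, up to a factor \<open>p\<close>. The factors are pairwise coprime after removal of powers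
  of 2, so each of them is a square, apart from at most one that is \<open>p\<close> times a square.

  For the first two families, every distribution of \<open>p\<close> either fails modulo a power of 2 or gives one
  of the equations \<open>X\<^sup>4 \<plusminus> Y\<^sup>4 = Z\<^sup>2\<close>, \<open>X\<^sup>4 \<plusminus> 4Y\<^sup>4 = Z\<^sup>2\<close>,
  \<open>X\<^sup>4 + 2Y\<^sup>4 = Z\<^sup>2\<close>, \<open>X\<^sup>4 + Y\<^sup>4 = 2Z\<^sup>2\<close>, which are settled by infinite descent; the point
  \<open>x = 6\<close> comes from the trivial solution \<open>X = Y\<close> of the last one.

  For the other two families only \<open>p \<equiv> 5 (mod 8)\<close> matters. What survives modulo 8 is three squares in
  arithmetic progression whose common difference is \<open>4qb\<^sup>4\<close> or \<open>8qb\<^sup>4\<close> with \<open>q\<close> a power of \<open>p\<close>.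
  Such a difference is \<open>4st(s + t)(2s + t)\<close> with coprime \<open>s, t\<close>, so all but one of \<open>s\<close>, \<open>t\<close>, \<open>s + t\<close>, \<open>2s + t\<close>
  are fourth powers up to a factor 2, and the linear relations between them contradict the same
  quartic equations.
\<close>

section \<open>Coprime factors of powers\<close>

text \<open>A prime divides at most one of two coprime numbers, so one of them is coprime to
  \<open>p ^ j\<close> and the other absorbs all of it. After cancelling \<open>p ^ j\<close>,
  coprime factors of an \<open>n\<close>-th power are \<open>n\<close>-th powers.\<close>

lemma coprime_mult_eq_prime_power_times_power:
  fixes a b w p :: nat
  assumes "prime p" "n > 0" "coprime a b" "a > 0" "b > 0" "a * b = p ^ j * w ^ n"
  obtains (left) u v where "a = p ^ j * u ^ n" "b = v ^ n" "w = u * v"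
    | (right) u v where "a = u ^ n" "b = p ^ j * v ^ n" "w = u * v"
proof -
  have aux: "\<exists>u v. a = p ^ j * u ^ n \<and> b = v ^ n \<and> w = u * v"
    if "coprime a b" "a > 0" "b > 0" "a * b = p ^ j * w ^ n" "coprime (p ^ j) b" for a b :: nat
  proof -
    have "p ^ j dvd a"
      using that(4,5) by (metis coprime_dvd_mult_left_iff dvd_triv_left)
    then obtain a' where a': "a = p ^ j * a'" ..
    have "p ^ j > 0" using \<open>prime p\<close> by (simp add: prime_gt_0_nat)
    then have eq: "a' * b = w ^ n"
      using that(4) unfolding a' by (metis less_numeral_extra(3) mult.assoc mult_left_cancel)
    have "is_nth_power n a'" "is_nth_power n b"
      using is_nth_power_mult_coprime_natD[of a' b n] that a' eq by auto
    then obtain u v where uv: "a' = u ^ n" "b = v ^ n"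
      by (auto simp: is_nth_power_def)
    then have "w ^ n = (u * v) ^ n" using eq by (simp add: power_mult_distrib)
    then have "w = u * v" using \<open>n > 0\<close> by (simp add: power_eq_iff_eq_base)
    then show ?thesis using uv a' by blast
  qed
  have "coprime (p ^ j) b \<or> coprime (p ^ j) a"
    using assms(1,3)
    by (metis coprime_commute coprime_power_left_iff dvd_def coprime_common_divisor
        not_prime_unit prime_imp_coprime)
  then show ?thesis
  proof
    assume "coprime (p ^ j) b"
    then show ?thesis using aux[of a b] assms left by blast
  next
    assume "coprime (p ^ j) a"
    then show ?thesis using aux[of b a] assms right
      by (metis coprime_commute mult.commute)
  qed
qed

lemma coprime_mult_eq_power:
  fixes a b w :: nat
  assumes "n > 0" "coprime a b" "a > 0" "b > 0" "a * b = w ^ n"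
  obtains u v where "a = u ^ n" "b = v ^ n" "w = u * v"
  \<comment> \<open>Exponent \<open>0\<close> turns the prime-power factor into 1; the prime 2 is an
    arbitrary choice.\<close>
  using coprime_mult_eq_prime_power_times_power[of 2 n a b 0 w] assms by auto

text \<open>Grouping the factors as \<open>(a * b) * (c * d)\<close>, the two-factor lemma sends
  \<open>p ^ j\<close> into one pair. That pair is split again with the prime power, the other one
  as a plain power.\<close>

lemma four_coprime_mult_eq_prime_power_times_power:
  fixes a b c d w p :: nat
  assumes "prime p" "n > 0" "a > 0" "b > 0" "c > 0" "d > 0"
    and "coprime a b" "coprime a c" "coprime a d" "coprime b c" "coprime b d" "coprime c d"
    and "a * b * c * d = p ^ j * w ^ n"
  obtains (1) t u v x where "a = p ^ j * t ^ n" "b = u ^ n" "c = v ^ n" "d = x ^ n"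
    | (2) t u v x where "a = t ^ n" "b = p ^ j * u ^ n" "c = v ^ n" "d = x ^ n"
    | (3) t u v x where "a = t ^ n" "b = u ^ n" "c = p ^ j * v ^ n" "d = x ^ n"
    | (4) t u v x where "a = t ^ n" "b = u ^ n" "c = v ^ n" "d = p ^ j * x ^ n"
proof -
  have cop: "coprime (a * b) (c * d)" using assms by auto
  have eq: "(a * b) * (c * d) = p ^ j * w ^ n" using assms(13) by (simp add: mult.assoc)
  have pos: "a * b > 0" "c * d > 0" using assms by auto
  from assms(1,2) cop pos eq show ?thesis
  proof (cases rule: coprime_mult_eq_prime_power_times_power)
    case (left u v)
    obtain c' d' where "c = c' ^ n" "d = d' ^ n"
      using coprime_mult_eq_power[of n c d v] assms left by metis
    with left assms show ?thesis
      using coprime_mult_eq_prime_power_times_power[of p n a b j u] 1 2 by metis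
  next
    case (right u v)
    obtain a' b' where "a = a' ^ n" "b = b' ^ n"
      using coprime_mult_eq_power[of n a b u] assms right by metis
    with right assms show ?thesis
      using coprime_mult_eq_prime_power_times_power[of p n c d j v] 3 4 by metis
  qed
qed

lemma four_coprime_mult_eq_power:
  fixes a b c d w :: nat
  assumes "n > 0" "a > 0" "b > 0" "c > 0" "d > 0"
    and "coprime a b" "coprime a c" "coprime a d" "coprime b c" "coprime b d" "coprime c d"
    and "a * b * c * d = w ^ n"
  obtains t u v x where "a = t ^ n" "b = u ^ n" "c = v ^ n" "d = x ^ n"
proof -
  have eq: "a * b * c * d = 2 ^ 0 * w ^ n" using assms(12) by simp
  from two_is_prime_nat show ?thesis
    by (rule four_coprime_mult_eq_prime_power_times_power[OF _ assms(1-11) eq]) (simp_all add: that)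
qed

text \<open>The engine of the descents: both roots are odd, so their difference is even, and
  \<open>z ^ 2 - w ^ 2\<close> becomes four times the product of \<open>k\<close> and
  \<open>w + k\<close>. As \<open>k\<close> divides \<open>m\<close>, it is coprime to
  \<open>w\<close>, so powers can be split over the two factors.\<close>

lemma odd_square_difference:
  fixes w z m :: nat
  assumes "odd w" "coprime w m" "z ^ 2 = w ^ 2 + 4 * m"
  obtains k where "z = w + 2 * k" "k * (w + k) = m" "coprime k (w + k)"
proof -
  have "w \<le> z" using assms(3) by (metis le_add1 power2_nat_le_imp_le power2_nat_le_eq_le)
  moreover have "odd z"
    using assms(1,3) by (metis even_add even_mult_iff even_numeral even_power pos2)
  ultimately obtain k where k: "z = w + 2 * k"
    using assms(1) by (metis add.commute even_add le_Suc_ex oddE dvdE)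
  have 1: "k * (w + k) = m"
    using assms(3) unfolding k by (simp add: power2_eq_square algebra_simps)
  have "coprime w k" using assms(2) 1 by (metis coprime_mult_right_iff)
  then have "coprime k (w + k)"
    by (metis add.commute coprime_commute coprime_iff_gcd_eq_1 gcd_add2)
  with k 1 that show ?thesis by blast
qed

section \<open>Residues of odd squares and fourth powers modulo 8\<close>

lemma odd_square_mod_8: "odd (x::nat) \<Longrightarrow> x ^ 2 mod 8 = 1"
proof -
  assume "odd x"
  then have "x mod 8 \<in> {1,3,5,7}"
    by auto presburger
  then have "(x mod 8) ^ 2 mod 8 = 1" by auto
  then show ?thesis by (simp add: power_mod)
qed

lemma odd_fourth_power_mod_8: "odd (x::nat) \<Longrightarrow> x ^ 4 mod 8 = 1"
  using odd_square_mod_8[of "x ^ 2"] by (simp flip: power_mult)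

section \<open>Fourth-power descents\<close>

lemma coprime_4_iff_odd: "coprime x 4 \<longleftrightarrow> odd (x::nat)"
  using coprime_power_right_iff[of x 2 2] by (simp add: coprime_right_2_iff_odd)

text \<open>Odd squares are 1 modulo 8, so their sum is 2 modulo 8.\<close>

lemma sum_of_odd_squares_neq_four_mult:
  fixes x y z :: nat
  assumes "odd x" "odd y"
  shows "x ^ 2 + y ^ 2 \<noteq> 4 * z"
proof -
  have "(x ^ 2 + y ^ 2) mod 8 = 2"
    using odd_square_mod_8[OF assms(1)] odd_square_mod_8[OF assms(2)]
    by (metis mod_add_eq mod_less numeral_Bit0 numeral_One one_add_one numeral_less_iff semiring_norm(76) semiring_norm(78))
  moreover have "(4 * z) mod 8 \<noteq> 2" by presburger
  ultimately show ?thesis by metis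
qed

lemma sum_of_odd_squares_not_square:
  fixes x y z :: nat
  assumes "odd x" "odd y"
  shows "x ^ 2 + y ^ 2 \<noteq> z ^ 2"
proof
  assume *: "x ^ 2 + y ^ 2 = z ^ 2"
  then have "even z" using assms by (metis even_add even_power)
  then obtain w where "z = 2 * w" ..
  with * sum_of_odd_squares_neq_four_mult[OF assms, of "w ^ 2"] show False
    by (simp add: power_mult_distrib)
qed

text \<open>Infinite descent on \<open>y\<close>. Splitting \<open>z ^ 2 - x ^ 4\<close> and then
  \<open>a ^ 4 - x ^ 2\<close> by \<open>odd_square_difference\<close> yields a solution
  \<open>s ^ 4 + 4 * t ^ 4 = a ^ 2\<close> of the same shape, with
  \<open>y = 2 * s * t * a\<close>.\<close>

lemma odd_fourth_power_plus_four_fourth_power_not_square: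
  fixes x y z :: nat
  assumes "odd x" "coprime x y" "y > 0"
  shows "x ^ 4 + 4 * y ^ 4 \<noteq> z ^ 2"
  using assms
proof (induction y arbitrary: x z rule: less_induct)
  case (less y x z)
  note [simp] = coprime_4_iff_odd
  show ?case
  proof
    assume eq: "x ^ 4 + 4 * y ^ 4 = z ^ 2"
    have "z ^ 2 = (x ^ 2) ^ 2 + 4 * y ^ 4" using eq by simp
    moreover have "odd (x ^ 2)" "coprime (x ^ 2) (y ^ 4)" using less.prems by simp_all
    ultimately obtain k where k: "k * (x ^ 2 + k) = y ^ 4" "coprime k (x ^ 2 + k)"
      by (elim odd_square_difference)
    have "k > 0" using k less.prems by (cases k) simp_all
    obtain b a where ab: "k = b ^ 4" "x ^ 2 + k = a ^ 4" "y = b * a"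
      by (rule coprime_mult_eq_power[OF _ k(2) _ _ k(1)]) (use \<open>k > 0\<close> in simp_all)
    \<comment> \<open>Here \<open>x ^ 2 + b ^ 4 = a ^ 4\<close>; an odd \<open>b\<close> would make
      the left side a sum of two odd squares.\<close>
    have "even b"
      using sum_of_odd_squares_not_square[of x "b ^ 2" "a ^ 2"] ab less.prems(1) by auto
    then obtain c where c: "b = 2 * c" by (elim evenE)
    have "c > 0" using ab c \<open>k > 0\<close> by simp
    have "(a ^ 2) ^ 2 = x ^ 2 + 4 * (4 * c ^ 4)" using ab c by (simp add: power_mult_distrib)
    moreover have "coprime x (4 * c ^ 4)"
      using less.prems unfolding ab c by simp
    ultimately obtain l where l: "a ^ 2 = x + 2 * l" "l * (x + l) = 4 * c ^ 4" "coprime l (x + l)"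
      using odd_square_difference[OF less.prems(1)] by blast
    have l2: "l * (x + l) = 2 ^ 2 * c ^ 4" using l(2) by simp
    have "l > 0" using l \<open>c > 0\<close> by (cases l) simp_all
    have "odd a" using arg_cong[OF l(1), of even] less.prems(1) by simp
    \<comment> \<open>The coprime factors \<open>l\<close> and \<open>x + l\<close> add up to
      \<open>a ^ 2\<close> and multiply to \<open>4 * c ^ 4\<close>. One is a fourth power and the
      other four times one; the sum has the desired form in either order.\<close>
    have "\<exists>s t. a ^ 2 = s ^ 4 + 4 * t ^ 4 \<and> c = s * t \<and> coprime (s ^ 4) (4 * t ^ 4)"
    proof (rule coprime_mult_eq_prime_power_times_power[OF two_is_prime_nat _ l(3) _ _ l2])
      fix u v assume *: "l = 2 ^ 2 * u ^ 4" "x + l = v ^ 4" "c = u * v"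
      then have "a ^ 2 = v ^ 4 + 4 * u ^ 4" "coprime (v ^ 4) (4 * u ^ 4)"
        using l by (simp_all add: coprime_commute)
      then show ?thesis using * by (metis mult.commute)
    next
      fix u v assume *: "l = u ^ 4" "x + l = 2 ^ 2 * v ^ 4" "c = u * v"
      then have "a ^ 2 = u ^ 4 + 4 * v ^ 4" "coprime (u ^ 4) (4 * v ^ 4)"
        using l by simp_all
      then show ?thesis using * by metis
    qed (use \<open>l > 0\<close> in simp_all)
    then obtain s t where st: "a ^ 2 = s ^ 4 + 4 * t ^ 4" "c = s * t" "coprime (s ^ 4) (4 * t ^ 4)"
      by blast
    then have "odd s" "coprime s t" "t > 0" using \<open>c > 0\<close> by simp_all
    moreover have "t < y"
    proof -
      have "y = t * (2 * s * a)" using ab c st by simp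
      moreover have "s > 0" "a > 0" using \<open>odd s\<close> \<open>odd a\<close> by (auto intro: Nat.gr0I)
      ultimately have "2 * s * a > 1" by (simp add: Suc_lessI)
      with \<open>y = t * (2 * s * a)\<close> \<open>t > 0\<close> show ?thesis by simp
    qed
    ultimately show False using less.IH[of t s a] st by simp
  qed
qed

section \<open>Reduction of the quartic equations to coprime variables\<close>

lemma coprime_quotients:
  fixes x y :: nat
  assumes "x > 0" "y > 0"
  obtains d a b where "d > 0" "x = d * a" "y = d * b" "coprime a b" "a > 0" "b > 0"
proof -
  obtain a b where *: "x = gcd x y * a" "y = gcd x y * b" "coprime a b"
    using assms by (metis gcd_coprime_exists mult.commute gcd_eq_0_iff not_gr0)
  show ?thesis
    by (rule that[of "gcd x y" a b]) (use * assms in \<open>auto intro: Nat.gr0I\<close>)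
qed

lemma fourth_power_dvd_square:
  fixes d z :: nat
  assumes "d ^ 4 dvd z ^ 2"
  obtains w where "z = d ^ 2 * w"
proof -
  have "(d ^ 2) ^ 2 dvd z ^ 2" using assms by simp
  then have "d ^ 2 dvd z" by (simp only: pow_divides_pow_iff pos2)
  then show ?thesis using that by blast
qed

text \<open>With \<open>d\<close> the greatest common divisor, \<open>d ^ 4\<close> divides the left
  side, so \<open>d ^ 2\<close> divides \<open>z\<close> and the whole equation can be divided by
  \<open>d ^ 4\<close>.\<close>

lemma coprime_quotients_fourth_powers:
  fixes x y z m :: nat
  assumes "x > 0" "y > 0" "x ^ 4 + m * y ^ 4 = z ^ 2"
  obtains d a b c where "x = d * a" "y = d * b" "z = d ^ 2 * c" "coprime a b" "a > 0" "b > 0"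
    "a ^ 4 + m * b ^ 4 = c ^ 2"
proof -
  obtain d a b where d: "d > 0" "x = d * a" "y = d * b" "coprime a b" "a > 0" "b > 0"
    using coprime_quotients assms by metis
  have eq: "z ^ 2 = d ^ 4 * (a ^ 4 + m * b ^ 4)"
    using assms(3) d by (simp add: power_mult_distrib algebra_simps)
  then obtain c where c: "z = d ^ 2 * c" by (metis dvd_triv_left fourth_power_dvd_square)
  then have "d ^ 4 * (a ^ 4 + m * b ^ 4) = d ^ 4 * c ^ 2" using eq
    by (auto simp: power_mult_distrib simp flip: power_mult)
  then have "a ^ 4 + m * b ^ 4 = c ^ 2" using d(1) by (metis mult_left_cancel power_not_zero less_numeral_extra(3))
  with d c that show ?thesis by blast
qed

lemma fourth_power_plus_four_fourth_power_not_square: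
  fixes x y z :: nat
  assumes "x > 0" "y > 0"
  shows "x ^ 4 + 4 * y ^ 4 \<noteq> z ^ 2"
proof
  assume *: "x ^ 4 + 4 * y ^ 4 = z ^ 2"
  obtain d a b c where c: "x = d * a" "y = d * b" "z = d ^ 2 * c" "coprime a b" "a > 0" "b > 0"
    "a ^ 4 + 4 * b ^ 4 = c ^ 2"
    by (rule coprime_quotients_fourth_powers[OF assms *])
  show False
  proof (cases "odd a")
    case True
    then show ?thesis using c odd_fourth_power_plus_four_fourth_power_not_square by blast
  next
    case False
    then obtain e where e: "a = 2 * e" by (auto elim: evenE)
    then have "odd b" using c(4) by auto
    have "even c" using arg_cong[OF c(7), of even] False by simp
    then obtain f where f: "c = 2 * f" by (elim evenE)
    \<comment> \<open>Dividing by 4 exchanges the roles of the two variables, which brings the odd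
      one to the front.\<close>
    have "b ^ 4 + 4 * e ^ 4 = f ^ 2" using c(7) e f by (simp add: power_mult_distrib)
    moreover have "coprime b e" "e > 0" using c e by (auto simp: coprime_commute)
    ultimately show ?thesis
      using odd_fourth_power_plus_four_fourth_power_not_square \<open>odd b\<close> by blast
  qed
qed

text \<open>From \<open>z ^ 2 = x ^ 4 - y ^ 4\<close> the identity \<open>(x ^ 4 - y ^ 4) ^ 2 + 4 *
  x ^ 4 * y ^ 4 = (x ^ 4 + y ^ 4) ^ 2\<close> produces a forbidden solution with entries
  \<open>z\<close> and \<open>x * y\<close>.\<close>

lemma fourth_power_difference_not_square:
  fixes x y z :: nat
  assumes "y > 0" "z > 0"
  shows "y ^ 4 + z ^ 2 \<noteq> x ^ 4"
proof
  assume *: "y ^ 4 + z ^ 2 = x ^ 4"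
  then have "x > 0" using assms by (intro Nat.gr0I) simp
  have "z ^ 4 + 4 * (x * y) ^ 4 = (z ^ 2) ^ 2 + 4 * x ^ 4 * y ^ 4"
    by (simp add: power_mult_distrib)
  also have "\<dots> = (x ^ 4 + y ^ 4) ^ 2"
    unfolding *[symmetric] by (simp add: power2_eq_square algebra_simps)
  finally show False
    using fourth_power_plus_four_fourth_power_not_square[of z "x * y"] assms \<open>x > 0\<close> by simp
qed

text \<open>Descent on the even variable \<open>y\<close>: two splittings lead to
  \<open>s ^ 4 + t ^ 4 = a ^ 2\<close> with \<open>y = 2 * s * t * a\<close>.\<close>

lemma coprime_fourth_powers_sum_not_square:
  fixes x y z :: nat
  assumes "odd x" "even y" "coprime x y" "y > 0"
  shows "x ^ 4 + y ^ 4 \<noteq> z ^ 2"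
  using assms
proof (induction y arbitrary: x z rule: less_induct)
  case (less y x z)
  note [simp] = coprime_4_iff_odd
  show ?case
  proof
    assume eq: "x ^ 4 + y ^ 4 = z ^ 2"
    from less.prems(2) obtain c where c: "y = 2 * c" by (elim evenE)
    have "c > 0" using less.prems c by simp
    have "z ^ 2 = (x ^ 2) ^ 2 + 4 * (4 * c ^ 4)" using eq c by (simp add: power_mult_distrib)
    moreover have "odd (x ^ 2)" "coprime (x ^ 2) (4 * c ^ 4)" using less.prems unfolding c by simp_all
    ultimately obtain k where k: "k * (x ^ 2 + k) = 4 * c ^ 4" "coprime k (x ^ 2 + k)"
      by (elim odd_square_difference)
    have k2: "k * (x ^ 2 + k) = 2 ^ 2 * c ^ 4" using k by simp
    have "k > 0" using k \<open>c > 0\<close> by (cases k) simp_all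
    \<comment> \<open>If the factor 4 sat in \<open>x ^ 2 + k\<close>, then
      \<open>x ^ 2 + u ^ 4 = 4 * v ^ 4\<close> would be a sum of two odd squares divisible by 4; so
      it sits in \<open>k\<close>.\<close>
    have "\<exists>a b. a ^ 4 = x ^ 2 + 4 * b ^ 4 \<and> c = a * b \<and> coprime (a ^ 4) (4 * b ^ 4)"
    proof (rule coprime_mult_eq_prime_power_times_power[OF two_is_prime_nat _ k(2) _ _ k2])
      fix u v assume *: "k = 2 ^ 2 * u ^ 4" "x ^ 2 + k = v ^ 4" "c = u * v"
      then have "v ^ 4 = x ^ 2 + 4 * u ^ 4" "coprime (v ^ 4) (4 * u ^ 4)"
        using k by (simp_all add: coprime_commute)
      then show ?thesis using * by (metis mult.commute)
    next
      fix u v assume *: "k = u ^ 4" "x ^ 2 + k = 2 ^ 2 * v ^ 4" "c = u * v"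
      then have eq: "x ^ 2 + (u ^ 2) ^ 2 = 4 * v ^ 4" by simp
      then have "even (x ^ 2 + (u ^ 2) ^ 2)" by simp
      then have "odd u" using less.prems(1) by simp
      then show ?thesis
        using sum_of_odd_squares_neq_four_mult[of x "u ^ 2" "v ^ 4"] eq less.prems(1)
        by simp
    qed (use \<open>k > 0\<close> in simp_all)
    then obtain a b where ab: "a ^ 4 = x ^ 2 + 4 * b ^ 4" "c = a * b" "coprime (a ^ 4) (4 * b ^ 4)"
      by blast
    have "odd a" using arg_cong[OF ab(1), of even] less.prems(1) by simp
    have "b > 0" using ab \<open>c > 0\<close> by simp
    have "(a ^ 2) ^ 2 = x ^ 2 + 4 * b ^ 4" using ab by simp
    moreover have "coprime x (b ^ 4)" using less.prems(3) unfolding c ab by simp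
    ultimately obtain l where l: "a ^ 2 = x + 2 * l" "l * (x + l) = b ^ 4" "coprime l (x + l)"
      using odd_square_difference[OF less.prems(1)] by blast
    have "l > 0" using l \<open>b > 0\<close> by (cases l) simp_all
    obtain s t where st: "l = s ^ 4" "x + l = t ^ 4" "b = s * t"
      by (rule coprime_mult_eq_power[OF _ l(3) _ _ l(2)]) (use \<open>l > 0\<close> in simp_all)
    have eq': "a ^ 2 = s ^ 4 + t ^ 4" using l st by simp
    have cop: "coprime s t" using l(3) st(1,2) by (metis coprime_power_left_iff coprime_power_right_iff zero_neq_numeral)
    have "s > 0" "t > 0" "a > 0" using st \<open>b > 0\<close> \<open>odd a\<close> by (auto intro: Nat.gr0I)
    \<comment> \<open>Either \<open>s\<close> or \<open>t\<close> may be the even one that continues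
      the descent, so both are bounded by \<open>y\<close>.\<close>
    have "y = s * (2 * t * a)" "y = t * (2 * s * a)" using c ab st by simp_all
    moreover have "2 * t * a > 1" "2 * s * a > 1" using \<open>s > 0\<close> \<open>t > 0\<close> \<open>a > 0\<close>
      by (simp_all add: Suc_lessI)
    ultimately have "s < y" "t < y" using \<open>s > 0\<close> \<open>t > 0\<close> by simp_all
    show False
    proof (cases "odd s")
      case True
      then have "even t" using arg_cong[OF eq', of even] \<open>odd a\<close> by simp
      then show ?thesis using less.IH[OF \<open>t < y\<close> True _ cop \<open>t > 0\<close>, of a] eq' by simp
    next
      case False
      then have "odd t" using arg_cong[OF eq', of even] \<open>odd a\<close> by simp
      then show ?thesis using less.IH[OF \<open>s < y\<close> _ _ _ \<open>s > 0\<close>, of t a] False cop eq'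
        by (simp add: coprime_commute add.commute)
    qed
  qed
qed

lemma fourth_powers_sum_not_square:
  fixes x y z :: nat
  assumes "x > 0" "y > 0"
  shows "x ^ 4 + y ^ 4 \<noteq> z ^ 2"
proof
  assume "x ^ 4 + y ^ 4 = z ^ 2"
  then have *: "x ^ 4 + 1 * y ^ 4 = z ^ 2" by simp
  obtain d a b c where c: "x = d * a" "y = d * b" "z = d ^ 2 * c" "coprime a b" "a > 0" "b > 0"
    "a ^ 4 + 1 * b ^ 4 = c ^ 2"
    by (rule coprime_quotients_fourth_powers[OF assms *])
  have c': "a ^ 4 + b ^ 4 = c ^ 2" using c(7) by simp
  have "\<not> (odd a \<and> odd b)"
    using sum_of_odd_squares_not_square[of "a ^ 2" "b ^ 2" c] c' by auto
  moreover have "\<not> (even a \<and> even b)" using c(4) by auto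
  ultimately consider "odd a" "even b" | "even a" "odd b" by blast
  then show False
    using coprime_fourth_powers_sum_not_square[of a b c]
      coprime_fourth_powers_sum_not_square[of b a c] c(4-6) c'
    by cases (simp_all add: coprime_commute add.commute)
qed

text \<open>Since \<open>z ^ 2 = x ^ 4 - 4 * y ^ 4\<close>, adding \<open>16 * x ^ 4 * y ^ 4\<close>
  to \<open>z ^ 4\<close> completes the square \<open>(x ^ 4 + 4 * y ^ 4) ^ 2\<close>; the added
  term is the fourth power of \<open>2 * x * y\<close>.\<close>

lemma four_fourth_power_plus_square_not_fourth_power:
  fixes x y z :: nat
  assumes "y > 0" "z > 0"
  shows "4 * y ^ 4 + z ^ 2 \<noteq> x ^ 4"
proof
  assume *: "4 * y ^ 4 + z ^ 2 = x ^ 4"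
  then have "x > 0" using assms by (intro Nat.gr0I) simp
  have "z ^ 4 + (2 * x * y) ^ 4 = (z ^ 2) ^ 2 + 16 * x ^ 4 * y ^ 4"
    by (simp add: power_mult_distrib)
  also have "\<dots> = (x ^ 4 + 4 * y ^ 4) ^ 2"
    unfolding *[symmetric] by (simp add: power2_eq_square algebra_simps)
  finally show False
    using fourth_powers_sum_not_square[of z "2 * x * y"] assms \<open>x > 0\<close> by simp
qed

text \<open>Multiplying by \<open>x ^ 4\<close> and adding \<open>y ^ 8\<close> gives
  \<open>(y ^ 2) ^ 4 + (z * x) ^ 4 = (x ^ 4 + y ^ 4) ^ 2\<close>, a sum of two fourth powers that is
  a square.\<close>

lemma fourth_power_plus_two_fourth_power_neq_fourth_power:
  fixes x y z :: nat
  assumes "x > 0" "y > 0"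
  shows "x ^ 4 + 2 * y ^ 4 \<noteq> z ^ 4"
proof
  assume *: "x ^ 4 + 2 * y ^ 4 = z ^ 4"
  then have "z > 0" using assms by (intro Nat.gr0I) simp
  have "(y ^ 2) ^ 4 + (z * x) ^ 4 = (y ^ 4) ^ 2 + z ^ 4 * x ^ 4"
    by (simp add: power_mult_distrib)
  also have "\<dots> = (x ^ 4 + y ^ 4) ^ 2"
    unfolding *[symmetric] by (simp add: power2_eq_square algebra_simps)
  finally show False
    using fourth_powers_sum_not_square[of "y ^ 2" "z * x" "x ^ 4 + y ^ 4"] assms \<open>z > 0\<close>
    by (metis mult_pos_pos zero_less_power)
qed

text \<open>For \<open>y < x\<close>, half the sum and half the difference of the fourth powers are
  \<open>z ^ 2\<close> and \<open>w\<close>. Their squares differ by \<open>(x * y) ^ 4\<close>, so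
  \<open>z ^ 4 - (x * y) ^ 4 = w ^ 2\<close>, which is excluded.\<close>

lemma fourth_powers_sum_eq_twice_square:
  fixes x y z :: nat
  assumes "x > 0" "y > 0" "x ^ 4 + y ^ 4 = 2 * z ^ 2"
  shows "x = y"
proof -
  have aux: False if "y < x" "y > 0" "x ^ 4 + y ^ 4 = 2 * z ^ 2" for x y :: nat
  proof -
    have "even (x ^ 4 + y ^ 4)" using that by simp
    then have "even (x ^ 4 - y ^ 4)" by auto
    then obtain w where w: "x ^ 4 - y ^ 4 = 2 * w" by (elim evenE)
    have "y ^ 4 < x ^ 4" using that(1) by (simp add: power_strict_mono)
    then have w': "x ^ 4 = y ^ 4 + 2 * w" "w > 0" using w by linarith+
    then have z: "z ^ 2 = y ^ 4 + w" using that by simp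
    have "(x * y) ^ 4 + w ^ 2 = (z ^ 2) ^ 2"
      unfolding z by (simp add: power_mult_distrib w' power2_eq_square algebra_simps)
    then show False
      using fourth_power_difference_not_square[of "x * y" w z] that w' by simp
  qed
  show ?thesis
    using aux[of x y] aux[of y x] assms by (metis add.commute linorder_neqE_nat)
qed

text \<open>Descent on \<open>y\<close> as before: the first splitting gives
  \<open>a ^ 4 = x ^ 2 + 8 * b ^ 4\<close>, the second \<open>a ^ 2 = s ^ 4 + 2 * t ^ 4\<close> with
  \<open>y = 2 * s * t * a\<close>.\<close>

lemma odd_fourth_power_plus_two_fourth_power_not_square:
  fixes x y z :: nat
  assumes "odd x" "coprime x y" "y > 0"
  shows "x ^ 4 + 2 * y ^ 4 \<noteq> z ^ 2"
  using assms
proof (induction y arbitrary: x z rule: less_induct)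
  case (less y x z)
  note [simp] = coprime_4_iff_odd coprime_right_2_iff_odd
  show ?case
  proof
    assume eq: "x ^ 4 + 2 * y ^ 4 = z ^ 2"
    \<comment> \<open>For odd \<open>y\<close> the left side is 3 modulo 8, not an odd
      square.\<close>
    have "even y"
    proof (rule ccontr)
      assume "odd y"
      then have "(x ^ 4 + 2 * y ^ 4) mod 8 = (1 + 2 * 1) mod 8"
        using odd_fourth_power_mod_8 less.prems(1)
        by (intro mod_add_cong mod_mult_cong) simp_all
      moreover have "odd z" using arg_cong[OF eq, of even] less.prems(1) by simp
      ultimately show False using odd_square_mod_8[of z] eq by simp
    qed
    then obtain c where c: "y = 2 * c" by (elim evenE)
    have "c > 0" using less.prems c by simp
    have "z ^ 2 = (x ^ 2) ^ 2 + 4 * (8 * c ^ 4)" using eq c by (simp add: power_mult_distrib)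
    moreover have "odd (x ^ 2)" "coprime (x ^ 2) (8 * c ^ 4)"
      using less.prems coprime_power_right_iff[of x 2 3] unfolding c by simp_all
    ultimately obtain k where k: "k * (x ^ 2 + k) = 8 * c ^ 4" "coprime k (x ^ 2 + k)"
      by (elim odd_square_difference)
    have k2: "k * (x ^ 2 + k) = 2 ^ 3 * c ^ 4" using k by simp
    have "k > 0" using k \<open>c > 0\<close> by (cases k) simp_all
    have "\<exists>a b. a ^ 4 = x ^ 2 + 8 * b ^ 4 \<and> c = a * b"
    proof (rule coprime_mult_eq_prime_power_times_power[OF two_is_prime_nat _ k(2) _ _ k2])
      fix u v assume *: "k = 2 ^ 3 * u ^ 4" "x ^ 2 + k = v ^ 4" "c = u * v"
      then have "v ^ 4 = x ^ 2 + 8 * u ^ 4"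
        by simp
      then show ?thesis using * by (metis mult.commute)
    next
      fix u v assume *: "k = u ^ 4" "x ^ 2 + k = 2 ^ 3 * v ^ 4" "c = u * v"
      then have eq: "x ^ 2 + (u ^ 2) ^ 2 = 4 * (2 * v ^ 4)" by simp
      then have "even (x ^ 2 + (u ^ 2) ^ 2)" by simp
      then have "odd u" using less.prems(1) by simp
      then show ?thesis
        using sum_of_odd_squares_neq_four_mult[of x "u ^ 2" "2 * v ^ 4"] eq less.prems(1)
        by simp
    qed (use \<open>k > 0\<close> in simp_all)
    then obtain a b where ab: "a ^ 4 = x ^ 2 + 8 * b ^ 4" "c = a * b"
      by blast
    have "odd a" using arg_cong[OF ab(1), of even] less.prems(1) by simp
    have "b > 0" using ab \<open>c > 0\<close> by simp
    have "(a ^ 2) ^ 2 = x ^ 2 + 4 * (2 * b ^ 4)" using ab by simp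
    moreover have "coprime x (2 * b ^ 4)" using less.prems unfolding c ab by simp
    ultimately obtain l where l: "a ^ 2 = x + 2 * l" "l * (x + l) = 2 * b ^ 4" "coprime l (x + l)"
      using odd_square_difference[OF less.prems(1)] by blast
    have l2: "l * (x + l) = 2 ^ 1 * b ^ 4" using l by simp
    have "l > 0" using l \<open>b > 0\<close> by (cases l) simp_all
    have "\<exists>s t. a ^ 2 = s ^ 4 + 2 * t ^ 4 \<and> b = s * t \<and> coprime (s ^ 4) (2 * t ^ 4)"
    proof (rule coprime_mult_eq_prime_power_times_power[OF two_is_prime_nat _ l(3) _ _ l2])
      fix u v assume *: "l = 2 ^ 1 * u ^ 4" "x + l = v ^ 4" "b = u * v"
      then have "a ^ 2 = v ^ 4 + 2 * u ^ 4" "coprime (v ^ 4) (2 * u ^ 4)"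
        using l by (simp_all add: coprime_commute)
      then show ?thesis using * by (metis mult.commute)
    next
      fix u v assume *: "l = u ^ 4" "x + l = 2 ^ 1 * v ^ 4" "b = u * v"
      then have "a ^ 2 = u ^ 4 + 2 * v ^ 4" "coprime (u ^ 4) (2 * v ^ 4)"
        using l by simp_all
      then show ?thesis using * by metis
    qed (use \<open>l > 0\<close> in simp_all)
    then obtain s t where st: "a ^ 2 = s ^ 4 + 2 * t ^ 4" "b = s * t" "coprime (s ^ 4) (2 * t ^ 4)"
      by blast
    then have "odd s" "coprime s t" "t > 0" using \<open>b > 0\<close> by simp_all
    moreover have "t < y"
    proof -
      have "y = t * (2 * s * a)" using ab c st by simp
      moreover have "s > 0" "a > 0" using \<open>odd s\<close> \<open>odd a\<close> by (auto intro: Nat.gr0I)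
      ultimately have "2 * s * a > 1" by (simp add: Suc_lessI)
      with \<open>y = t * (2 * s * a)\<close> \<open>t > 0\<close> show ?thesis by simp
    qed
    ultimately show False using less.IH[of t s a] st by simp
  qed
qed

section \<open>Squares in arithmetic progression\<close>

text \<open>The product of the outer squares \<open>r ^ 2\<close> and \<open>B ^ 2\<close> is
  \<open>A ^ 4 - s ^ 4\<close>, a difference of fourth powers that is a square.\<close>

lemma no_progression_with_square_difference:
  fixes r s A B :: nat
  assumes "r > 0" "s > 0" "r ^ 2 + s ^ 2 = A ^ 2" "r ^ 2 + 2 * s ^ 2 = B ^ 2"
  shows False
proof -
  have "B > 0" using assms by (intro Nat.gr0I) simp
  have "s ^ 4 + (r * B) ^ 2 = s ^ 4 + r ^ 2 * (r ^ 2 + 2 * s ^ 2)"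
    using assms by (simp add: power_mult_distrib)
  also have "\<dots> = (r ^ 2 + s ^ 2) ^ 2" by (simp add: power2_eq_square power4_eq_xxxx algebra_simps)
  finally show False
    using fourth_power_difference_not_square[of s "r * B" A] assms \<open>B > 0\<close> by simp
qed

text \<open>Here the product of the outer squares is \<open>B ^ 4 - 4 * r ^ 4\<close>.\<close>

lemma no_progression_with_twice_square_difference:
  fixes r s A B :: nat
  assumes "r > 0" "s > 0" "s ^ 2 + 4 * r ^ 2 = A ^ 2" "s ^ 2 + 2 * r ^ 2 = B ^ 2"
  shows False
proof -
  have "A > 0" using assms by (intro Nat.gr0I) simp
  have "4 * r ^ 4 + (s * A) ^ 2 = 4 * r ^ 4 + s ^ 2 * (s ^ 2 + 4 * r ^ 2)"
    using assms by (simp add: power_mult_distrib)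
  also have "\<dots> = (s ^ 2 + 2 * r ^ 2) ^ 2" by (simp add: power2_eq_square power4_eq_xxxx algebra_simps)
  finally show False
    using four_fourth_power_plus_square_not_fourth_power[of r "s * A" B] assms \<open>A > 0\<close> by simp
qed

text \<open>Writing \<open>A = x + 2 * h\<close>, the middle root \<open>B\<close> is the hypotenuse
  of a right triangle with legs \<open>h\<close> and \<open>x + h\<close>, and \<open>D\<close> is
  twice the product of the legs. The parametrization of primitive Pythagorean triples then factors
  \<open>D\<close>.\<close>

lemma squares_in_arithmetic_progression:
  fixes x D A B :: nat
  assumes "odd x" "coprime x D" "D > 0" "x ^ 2 + D = B ^ 2" "x ^ 2 + 2 * D = A ^ 2"
  obtains s t where "s > 0" "t > 0" "odd t" "coprime s t" "D = 4 * (s * t * (s + t) * (2 * s + t))"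
proof -
  \<comment> \<open>The triple is \<open>U = r ^ 2 - s ^ 2\<close>, \<open>V = 2 * r * s\<close>;
    putting \<open>r = s + t\<close> gives \<open>U = t * (2 * s + t)\<close> and
    \<open>V = 2 * s * (s + t)\<close>.\<close>
  have param: "\<exists>s t. s > 0 \<and> t > 0 \<and> odd t \<and> coprime s t \<and> U * V = 2 * (s * t * (s + t) * (2 * s + t))"
    if UV: "odd U" "even V" "V > 0" "coprime U V" "U ^ 2 + V ^ 2 = B ^ 2" for U V :: nat
  proof -
    from UV obtain W where W: "V = 2 * W" by (elim evenE)
    have "B ^ 2 = U ^ 2 + 4 * W ^ 2" using UV W by (simp add: power_mult_distrib)
    moreover have "coprime U (W ^ 2)" using UV W by simp
    ultimately obtain k where k: "k * (U + k) = W ^ 2" "coprime k (U + k)"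
      using odd_square_difference[OF UV(1)] by blast
    have "k > 0" using k UV W by (intro Nat.gr0I) simp
    obtain s r where sr: "k = s ^ 2" "U + k = r ^ 2" "W = s * r"
      by (rule coprime_mult_eq_power[OF _ k(2) _ _ k(1)]) (use \<open>k > 0\<close> in simp_all)
    have "U > 0" using UV(1) by (intro Nat.gr0I) simp
    then have "s ^ 2 < r ^ 2" using sr by simp
    then have "s < r" by (rule power_less_imp_less_base) simp
    then obtain t where t: "r = s + t" "t > 0" by (metis less_imp_add_positive)
    have U: "U = t * (2 * s + t)" using sr(1,2) t by (simp add: power2_eq_square algebra_simps)
    then have "odd t" using UV(1) by simp
    have "coprime (s ^ 2) (r ^ 2)" using k(2) unfolding sr(2) unfolding sr(1) .
    then have "coprime s (s + t)" unfolding t by simp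
    then have "coprime s t" by (metis coprime_iff_gcd_eq_1 gcd_add2)
    have "s > 0" using sr \<open>k > 0\<close> by simp
    have "U * V = 2 * (s * t * (s + t) * (2 * s + t))"
      unfolding U W sr(3) t(1) by (simp add: algebra_simps)
    then show ?thesis using \<open>s > 0\<close> \<open>t > 0\<close> \<open>odd t\<close> \<open>coprime s t\<close> by blast
  qed
  have "x ^ 2 < A ^ 2" using assms(3,5) by linarith
  then have "x < A" by (rule power_less_imp_less_base) simp
  have "even (A ^ 2 - x ^ 2)" using assms(5) by (metis add_diff_cancel_left' dvd_triv_left)
  moreover have "odd (A ^ 2)" unfolding assms(5)[symmetric] using assms(1) by simp
  ultimately have "odd A" by simp
  then have "even (A - x)" using assms(1) by simp
  then obtain h where "A - x = 2 * h" by (elim evenE)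
  then have h: "A = x + 2 * h" "h > 0" using \<open>x < A\<close> by linarith+
  have D: "D = 2 * (h * (x + h))"
    using assms(5) unfolding h(1) by (simp add: power2_eq_square algebra_simps)
  have B: "h ^ 2 + (x + h) ^ 2 = B ^ 2"
    using assms(4) unfolding D by (simp add: power2_eq_square algebra_simps)
  have "coprime h x" using assms(2) unfolding D by (simp add: coprime_commute)
  then have cop: "coprime h (x + h)" by (metis add.commute coprime_iff_gcd_eq_1 gcd_add2)
  \<comment> \<open>As \<open>x\<close> is odd, exactly one leg is even, and the product is
    symmetric in the legs.\<close>
  have "\<exists>s t. s > 0 \<and> t > 0 \<and> odd t \<and> coprime s t \<and> h * (x + h) = 2 * (s * t * (s + t) * (2 * s + t))"
  proof (cases "odd h")
    case True
    then show ?thesis using param[of h "x + h"] cop B \<open>h > 0\<close> assms(1) by simp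
  next
    case False
    then show ?thesis using param[of "x + h" h] cop B \<open>h > 0\<close> assms(1)
      by (simp add: mult.commute coprime_commute add.commute)
  qed
  then show ?thesis using that D by (metis mult.assoc numeral_Bit0 mult_2 distrib_right)
qed

lemma coprime_progression_factors:
  fixes s t :: nat
  assumes "coprime s t" "odd t"
  shows "coprime s (s + t)" "coprime s (2 * s + t)" "coprime t (s + t)" "coprime t (2 * s + t)"
    "coprime (s + t) (2 * s + t)"
proof -
  show 1: "coprime s (s + t)" using assms by (metis coprime_iff_gcd_eq_1 gcd_add2)
  show "coprime s (2 * s + t)" using 1 
    by (metis coprime_iff_gcd_eq_1 gcd_add2 mult_2 add.assoc)
  show 3: "coprime t (s + t)" using assms 
    by (metis coprime_iff_gcd_eq_1 gcd_add2 add.commute coprime_commute)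
  have "coprime t (2 * s)" using assms by (simp add: coprime_commute coprime_right_2_iff_odd)
  then show "coprime t (2 * s + t)"
    by (metis coprime_iff_gcd_eq_1 gcd_add2 add.commute)
  have "coprime (s + t) s" using 1 by (simp add: coprime_commute)
  moreover have "2 * s + t = (s + t) + s" by simp
  ultimately show "coprime (s + t) (2 * s + t)"
    by (metis coprime_iff_gcd_eq_1 gcd_add2)
qed

text \<open>The four factors are pairwise coprime, so three of them are fourth powers. Any three
  satisfy a linear relation: \<open>t + (2 * s + t) = 2 * (s + t)\<close>,
  \<open>s + (s + t) = 2 * s + t\<close>, the form of \<open>2 * s + t\<close> in \<open>s\<close>
  and \<open>t\<close>, or that of \<open>s + t\<close>. Each is an excluded quartic equation,
  except that the first also allows \<open>s = 0\<close>, contrary to \<open>s > 0\<close>.\<close>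

lemma progression_product_neq_prime_power_times_fourth_power:
  fixes s t p b :: nat
  assumes "prime p" "s > 0" "t > 0" "odd t" "coprime s t"
  shows "s * t * (s + t) * (2 * s + t) \<noteq> p ^ j * b ^ 4"
proof
  assume eq: "s * t * (s + t) * (2 * s + t) = p ^ j * b ^ 4"
  note cop = coprime_progression_factors[OF assms(5,4)]
  from assms(1) show False
  proof (rule four_coprime_mult_eq_prime_power_times_power
      [OF _ _ _ _ _ _ assms(5) cop(1,2,3,4,5) eq])
    fix w u v x assume *: "t = u ^ 4" "s + t = v ^ 4" "2 * s + t = x ^ 4"
    then have "x ^ 4 + u ^ 4 = 2 * (v ^ 2) ^ 2" by simp
    moreover have "x > 0" "u > 0" using * assms by (auto intro: Nat.gr0I)
    ultimately have "x = u" using fourth_powers_sum_eq_twice_square by blast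
    then show False using * assms by simp
  next
    fix w u v x assume *: "s = w ^ 4" "s + t = v ^ 4" "2 * s + t = x ^ 4"
    then have "w ^ 4 + v ^ 4 = (x ^ 2) ^ 2" by simp
    moreover have "w > 0" "v > 0" using * assms by (auto intro: Nat.gr0I)
    ultimately show False using fourth_powers_sum_not_square by blast
  next
    fix w u v x assume *: "s = w ^ 4" "t = u ^ 4" "2 * s + t = x ^ 4"
    then have "u ^ 4 + 2 * w ^ 4 = x ^ 4" by simp
    moreover have "w > 0" "u > 0" using * assms by (auto intro: Nat.gr0I)
    ultimately show False using fourth_power_plus_two_fourth_power_neq_fourth_power by blast
  next
    fix w u v x assume *: "s = w ^ 4" "t = u ^ 4" "s + t = v ^ 4"
    then have "w ^ 4 + u ^ 4 = (v ^ 2) ^ 2" by simp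
    moreover have "w > 0" "u > 0" using * assms by (auto intro: Nat.gr0I)
    ultimately show False using fourth_powers_sum_not_square by blast
  qed (use assms in simp_all)
qed

text \<open>Since \<open>t\<close> and \<open>2 * s + t\<close> are odd, the factor 2 is taken out
  of \<open>s\<close> or of \<open>s + t\<close>. The same linear relations then apply with adjusted
  coefficients.\<close>

lemma progression_product_neq_twice_prime_power_times_fourth_power:
  fixes s t p b :: nat
  assumes "prime p" "p \<noteq> 3" "s > 0" "t > 0" "odd t" "coprime s t"
  shows "s * t * (s + t) * (2 * s + t) \<noteq> 2 * (p ^ j * b ^ 4)"
proof
  assume eq: "s * t * (s + t) * (2 * s + t) = 2 * (p ^ j * b ^ 4)"
  note cop = coprime_progression_factors[OF assms(6,5)]
  show False
  proof (cases "even s")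
    case True
    then obtain e where e: "s = 2 * e" by (elim evenE)
    have "e > 0" using e assms by simp
    have eq': "e * t * (s + t) * (2 * s + t) = p ^ j * b ^ 4" using eq e by simp
    have cop': "coprime e t" "coprime e (s + t)" "coprime e (2 * s + t)"
      using cop(1,2) assms(6) unfolding e by simp_all
    from assms(1) show False
    proof (rule four_coprime_mult_eq_prime_power_times_power
        [OF _ _ _ _ _ _ cop' cop(3,4,5) eq'])
      fix w u v x assume *: "t = u ^ 4" "s + t = v ^ 4" "2 * s + t = x ^ 4"
      then have "x ^ 4 + u ^ 4 = 2 * (v ^ 2) ^ 2" by simp
      moreover have "x > 0" "u > 0" using * assms by (auto intro: Nat.gr0I)
      ultimately have "x = u" using fourth_powers_sum_eq_twice_square by blast
      then show False using * assms by simp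
    next
      fix w u v x assume *: "e = w ^ 4" "s + t = v ^ 4" "2 * s + t = x ^ 4"
      then have "v ^ 4 + 2 * w ^ 4 = x ^ 4" using e by simp
      moreover have "w > 0" "v > 0" using * assms \<open>e > 0\<close> by (auto intro: Nat.gr0I)
      ultimately show False using fourth_power_plus_two_fourth_power_neq_fourth_power by blast
    next
      fix w u v x assume *: "e = w ^ 4" "t = u ^ 4" "2 * s + t = x ^ 4"
      then have "u ^ 4 + 4 * w ^ 4 = (x ^ 2) ^ 2" using e by simp
      moreover have "w > 0" "u > 0" using * assms \<open>e > 0\<close> by (auto intro: Nat.gr0I)
      ultimately show False using fourth_power_plus_four_fourth_power_not_square by blast
    next
      fix w u v x assume *: "e = w ^ 4" "t = u ^ 4" "s + t = v ^ 4"
      then have "u ^ 4 + 2 * w ^ 4 = v ^ 4" using e by simp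
      moreover have "w > 0" "u > 0" using * assms \<open>e > 0\<close> by (auto intro: Nat.gr0I)
      ultimately show False using fourth_power_plus_two_fourth_power_neq_fourth_power by blast
    qed (use assms \<open>e > 0\<close> in simp_all)
  next
    case False
    then have "even (s + t)" using assms by simp
    then obtain e where e: "s + t = 2 * e" by (elim evenE)
    have "e > 0" using e assms by (intro Nat.gr0I) simp
    have eq': "s * t * e * (2 * s + t) = p ^ j * b ^ 4" using eq unfolding e by simp
    have cop': "coprime s e" "coprime t e" "coprime e (2 * s + t)"
      using cop(1,3,5) unfolding e by simp_all
    from assms(1) show False
    proof (rule four_coprime_mult_eq_prime_power_times_power
        [OF _ _ _ _ _ _ assms(6) cop'(1) cop(2) cop'(2) cop(4) cop'(3) eq'])
      fix w u v x assume *: "t = u ^ 4" "2 * s + t = x ^ 4"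
      have "odd t" "odd (2 * s + t)" using assms(5) by simp_all
      then have "odd u" "odd x" unfolding *(2) unfolding *(1) by simp_all
      moreover have "(x ^ 2) ^ 2 + (u ^ 2) ^ 2 = 4 * e" using * e by simp
      ultimately show False
        using sum_of_odd_squares_neq_four_mult[of "x ^ 2" "u ^ 2" e] by simp
    next
      fix w u v x assume *: "s = w ^ 4" "e = v ^ 4" "2 * s + t = x ^ 4"
      then have "w ^ 4 + 2 * v ^ 4 = x ^ 4" using e by simp
      moreover have "w > 0" "v > 0" using * assms \<open>e > 0\<close> by (auto intro: Nat.gr0I)
      ultimately show False using fourth_power_plus_two_fourth_power_neq_fourth_power by blast
    next
      fix w u v x assume *: "s = w ^ 4" "t = u ^ 4" "2 * s + t = x ^ 4"
      then have "u ^ 4 + 2 * w ^ 4 = x ^ 4" using e by simp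
      moreover have "w > 0" "u > 0" using * assms by (auto intro: Nat.gr0I)
      ultimately show False using fourth_power_plus_two_fourth_power_neq_fourth_power by blast
    next
      \<comment> \<open>The only case with a genuine solution: \<open>w = u\<close> and coprimality
        force \<open>s = t = 1\<close>, so \<open>2 * s + t = 3\<close>, which would make
        \<open>p\<close> equal to 3.\<close>
      fix w u v x assume *: "s = w ^ 4" "t = u ^ 4" "e = v ^ 4" "2 * s + t = p ^ j * x ^ 4"
      then have "w ^ 4 + u ^ 4 = 2 * (v ^ 2) ^ 2" using e by simp
      moreover have "w > 0" "u > 0" using * assms by (auto intro: Nat.gr0I)
      ultimately have "w = u" using fourth_powers_sum_eq_twice_square by blast
      then have "s = 1" "t = 1" using * assms(6) by simp_all
      then have 3: "p ^ j * x ^ 4 = 3" using * by simp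
      have "x < 2"
      proof (rule ccontr)
        assume "\<not> x < 2"
        then have "2 ^ 4 \<le> x ^ 4" by (intro power_mono) simp_all
        moreover have "x ^ 4 \<le> p ^ j * x ^ 4" using assms(1) by (simp add: prime_gt_0_nat Suc_le_eq)
        ultimately show False using 3 by simp
      qed
      then have "x = 1" using 3 by (cases "x = 0") simp_all
      then have "p ^ j = 3" using 3 by simp
      then have "p dvd 3" by (metis dvd_power neq0_conv numeral_eq_one_iff power_0 semiring_norm(86))
      then show False using assms(1,2) by (simp add: primes_dvd_imp_eq)
    qed (use assms \<open>e > 0\<close> in simp_all)
  qed
qed

section \<open>Pairwise coprime factors of the curve equation\<close>

text \<open>Both quadratic factors of the cleared curve equation have the shape \<open>u + d\<close>
  and \<open>u + 2 * d\<close>, with \<open>r\<close> and \<open>s\<close> dividing \<open>u\<close>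
  and \<open>d\<close>. Oddness of \<open>u\<close> is what separates \<open>u\<close> from
  \<open>u + 2 * d\<close>.\<close>

lemma coprime_factors:
  fixes u d r s :: nat
  assumes "coprime u d" "odd u" "r dvd u" "s dvd d"
  shows "coprime r s" "coprime r (u + d)" "coprime r (u + 2 * d)" "coprime s (u + d)"
    "coprime s (u + 2 * d)" "coprime (u + d) (u + 2 * d)"
proof -
  have add: "coprime a (a + b)" "coprime b (a + b)" if "coprime a b" for a b :: nat
    using that by (metis coprime_iff_gcd_eq_1 gcd_add2 add.commute coprime_commute)+
  have ud: "coprime u (u + d)" "coprime d (u + d)"
    using add assms(1) by blast+
  have "coprime u (2 * d)" using assms(1,2) by (simp add: coprime_right_2_iff_odd)
  then have u2d: "coprime u (u + 2 * d)" by (rule add)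
  have d2: "coprime d (u + 2 * d)" using add(2)[OF ud(2)[THEN coprime_commute[THEN iffD1]]] add(1)[OF ud(2)]
    by (metis add.assoc add.commute mult_2)
  show "coprime r s" using assms by (meson coprime_divisors)
  show "coprime r (u + d)" "coprime r (u + 2 * d)" "coprime s (u + d)" "coprime s (u + 2 * d)"
    using ud u2d d2 assms(3,4) by (meson coprime_divisors dvd_refl)+
  have "coprime (u + d) d" using ud(2) by (simp add: coprime_commute)
  from add(1)[OF this] show "coprime (u + d) (u + 2 * d)" by (simp add: mult_2 add.assoc)
qed

section \<open>Cancelling square and prime factors in an equation with a square\<close>

lemma square_mult_eq_square:
  fixes k x m :: nat
  assumes "k ^ 2 * x = m ^ 2" "k > 0"
  obtains w where "x = w ^ 2"
proof -
  have "k ^ 2 dvd m ^ 2" using assms(1) by (metis dvd_triv_left)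
  then have "k dvd m" by (simp only: pow_divides_pow_iff pos2)
  then obtain w where "m = k * w" ..
  then have "x = w ^ 2" using assms by (simp add: power_mult_distrib)
  then show ?thesis using that by blast
qed

lemma prime_mult_eq_square:
  fixes p x m :: nat
  assumes "prime p" "p * x = m ^ 2"
  obtains w where "x = p * w ^ 2"
proof -
  have "p dvd m ^ 2" using assms(2) by (metis dvd_triv_left)
  then have "p dvd m" using assms(1) prime_dvd_power by blast
  then obtain w where "m = p * w" ..
  then have "p * x = p * (p * w ^ 2)" using assms(2) by (auto simp: power2_eq_square)
  then have "x = p * w ^ 2" using assms(1) by auto
  then show ?thesis using that by blast
qed

text \<open>The integer equation of the family \<open>i = 0\<close>, \<open>j = 2\<close>. If
  \<open>p\<close> sits in \<open>r\<close> or \<open>s\<close>, both quadratic forms are squares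
  and give a forbidden progression. If it sits in one form, the other form becomes a quartic
  equation in the square roots of \<open>r\<close> and \<open>s\<close>.\<close>

lemma prime_times_form_not_square:
  fixes p r s m :: nat
  assumes "prime p" "r > 0" "s > 0" "coprime r s"
  shows "p * (r * s * (r ^ 2 + s ^ 2) * (r ^ 2 + 2 * s ^ 2)) \<noteq> m ^ 2"
proof
  assume eq: "p * (r * s * (r ^ 2 + s ^ 2) * (r ^ 2 + 2 * s ^ 2)) = m ^ 2"
  show False
  proof (cases "odd r")
    case True
    from assms(1) eq obtain w where "r * s * (r ^ 2 + s ^ 2) * (r ^ 2 + 2 * s ^ 2) = p * w ^ 2"
      by (rule prime_mult_eq_square)
    then have eq': "r * s * (r ^ 2 + s ^ 2) * (r ^ 2 + 2 * s ^ 2) = p ^ 1 * w ^ 2" by simp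
    have cop: "coprime (r ^ 2) (s ^ 2)" "odd (r ^ 2)" "r dvd r ^ 2" "s dvd s ^ 2"
      using True assms(4) by (simp_all add: dvd_power)
    from assms(1) show False
    proof (rule four_coprime_mult_eq_prime_power_times_power
        [OF _ _ _ _ _ _ coprime_factors[OF cop] eq'])
      fix t u v x assume *: "r ^ 2 + s ^ 2 = v ^ 2" "r ^ 2 + 2 * s ^ 2 = x ^ 2"
      then show False using no_progression_with_square_difference assms by blast
    next
      fix t u v x assume *: "r ^ 2 + s ^ 2 = v ^ 2" "r ^ 2 + 2 * s ^ 2 = x ^ 2"
      then show False using no_progression_with_square_difference assms by blast
    next
      fix t u v x assume *: "r = t ^ 2" "s = u ^ 2" "r ^ 2 + 2 * s ^ 2 = x ^ 2"
      then have "t ^ 4 + 2 * u ^ 4 = x ^ 2" by simp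
      moreover have "odd t" "t > 0" "u > 0" "coprime t u" using * True assms by simp_all
      ultimately show False using odd_fourth_power_plus_two_fourth_power_not_square by blast
    next
      fix t u v x assume *: "r = t ^ 2" "s = u ^ 2" "r ^ 2 + s ^ 2 = v ^ 2"
      then have "t ^ 4 + u ^ 4 = v ^ 2" by simp
      moreover have "t > 0" "u > 0" using * assms by simp_all
      ultimately show False using fourth_powers_sum_not_square by blast
    qed (use assms in simp_all)
  next
    case False
    then obtain e where e: "r = 2 * e" by (auto elim: evenE)
    have "odd s" using False assms(4) by auto
    have "e > 0" using e assms by simp
    \<comment> \<open>For \<open>r = 2 * e\<close> one factor 2 comes from \<open>r\<close> and one
      from \<open>r ^ 2 + 2 * s ^ 2\<close>; the remaining forms are \<open>u + d\<close> and
      \<open>u + 2 * d\<close> with \<open>u = s ^ 2\<close> and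
      \<open>d = 2 * e ^ 2\<close>.\<close>
    have "2 ^ 2 * (p * (s * e * (s ^ 2 + 2 * e ^ 2) * (s ^ 2 + 2 * (2 * e ^ 2)))) = m ^ 2"
      using eq unfolding e by (simp add: algebra_simps power2_eq_square)
    then obtain m' where m': "p * (s * e * (s ^ 2 + 2 * e ^ 2) * (s ^ 2 + 2 * (2 * e ^ 2))) = m' ^ 2"
      by (rule square_mult_eq_square) simp
    from assms(1) m' obtain w where "s * e * (s ^ 2 + 2 * e ^ 2) * (s ^ 2 + 2 * (2 * e ^ 2)) = p * w ^ 2"
      by (rule prime_mult_eq_square)
    then have eq': "s * e * (s ^ 2 + 2 * e ^ 2) * (s ^ 2 + 2 * (2 * e ^ 2)) = p ^ 1 * w ^ 2" by simp
    have cop: "coprime (s ^ 2) (2 * e ^ 2)" "odd (s ^ 2)" "s dvd s ^ 2" "e dvd 2 * e ^ 2"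
      using \<open>odd s\<close> assms(4) unfolding e
      by (simp_all add: dvd_power coprime_commute coprime_left_2_iff_odd)
    from assms(1) show False
    proof (rule four_coprime_mult_eq_prime_power_times_power
        [OF _ _ _ _ _ _ coprime_factors[OF cop] eq'])
      fix t u v x assume *: "s ^ 2 + 2 * e ^ 2 = v ^ 2" "s ^ 2 + 2 * (2 * e ^ 2) = x ^ 2"
      then show False using no_progression_with_twice_square_difference[of e s x v] assms \<open>e > 0\<close> by simp
    next
      fix t u v x assume *: "s ^ 2 + 2 * e ^ 2 = v ^ 2" "s ^ 2 + 2 * (2 * e ^ 2) = x ^ 2"
      then show False using no_progression_with_twice_square_difference[of e s x v] assms \<open>e > 0\<close> by simp
    next
      fix t u v x assume *: "s = t ^ 2" "e = u ^ 2" "s ^ 2 + 2 * (2 * e ^ 2) = x ^ 2"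
      then have "t ^ 4 + 4 * u ^ 4 = x ^ 2" by simp
      moreover have "t > 0" "u > 0" using * assms \<open>e > 0\<close> by simp_all
      ultimately show False using fourth_power_plus_four_fourth_power_not_square by blast
    next
      fix t u v x assume *: "s = t ^ 2" "e = u ^ 2" "s ^ 2 + 2 * e ^ 2 = v ^ 2"
      then have "t ^ 4 + 2 * u ^ 4 = v ^ 2" by simp
      moreover have "odd t" "t > 0" "u > 0" "coprime t u"
        using * \<open>odd s\<close> assms \<open>e > 0\<close> e by (simp_all add: coprime_commute)
      ultimately show False using odd_fourth_power_plus_two_fourth_power_not_square by blast
    qed (use assms \<open>e > 0\<close> in simp_all)
  qed
qed

lemma odd_square_neq_three_mod_four_mult_square:
  fixes x p v :: nat
  assumes "odd x" "p mod 4 = 3"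
  shows "x ^ 2 + 4 * k \<noteq> p * v ^ 2"
proof
  assume eq: "x ^ 2 + 4 * k = p * v ^ 2"
  have sq: "a ^ 2 mod 4 = 1" if "odd a" for a :: nat
  proof -
    have "a ^ 2 mod 4 = (a ^ 2 mod 8) mod 4" by (rule mod_mod_cancel[symmetric]) simp
    then show ?thesis using odd_square_mod_8[OF that] by simp
  qed
  have "odd v" using arg_cong[OF eq, of even] assms(1) by simp
  have "(p * v ^ 2) mod 4 = (3 * 1) mod 4"
    using assms(2) sq[OF \<open>odd v\<close>] by (intro mod_mult_cong) simp_all
  moreover have "(x ^ 2 + 4 * k) mod 4 = 1" using sq[OF assms(1)] by simp
  ultimately show False using eq by simp
qed

text \<open>The integer equation of the family \<open>i = 2\<close>, \<open>j = 2\<close>, split by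
  the parities of \<open>r\<close> and \<open>s\<close>. The residue 3 modulo 4 keeps
  \<open>p\<close> out of a form that is an odd square plus a multiple of 4.\<close>

lemma twice_prime_times_form_eq_square:
  fixes p r s m :: nat
  assumes "prime p" "p mod 4 = 3" "r > 0" "s > 0" "coprime r s"
    and eq: "2 * p * (r * s * (r ^ 2 + s ^ 2) * (r ^ 2 + 2 * s ^ 2)) = m ^ 2"
  shows "p = 3 \<and> r = 1 \<and> s = 1"
proof (cases "odd r")
  case True
  show ?thesis
  proof (cases "odd s")
    case s: True
    have "even (r ^ 2 + s ^ 2)" using True s by simp
    then obtain e where e: "r ^ 2 + s ^ 2 = 2 * e" by (elim evenE)
    have "e > 0" using e assms by (intro Nat.gr0I) simp
    have "2 ^ 2 * (p * (r * s * e * (r ^ 2 + 2 * s ^ 2))) = m ^ 2"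
      using eq unfolding e by (simp add: mult_ac)
    then obtain m' where m': "p * (r * s * e * (r ^ 2 + 2 * s ^ 2)) = m' ^ 2"
      by (rule square_mult_eq_square) simp
    from assms(1) m' obtain w where "r * s * e * (r ^ 2 + 2 * s ^ 2) = p * w ^ 2"
      by (rule prime_mult_eq_square)
    then have eq': "r * s * e * (r ^ 2 + 2 * s ^ 2) = p ^ 1 * w ^ 2" by simp
    have cop: "coprime (r ^ 2) (s ^ 2)" "odd (r ^ 2)" "r dvd r ^ 2" "s dvd s ^ 2"
      using True assms by (simp_all add: dvd_power)
    have cop': "coprime r e" "coprime s e" "coprime e (r ^ 2 + 2 * s ^ 2)"
      using coprime_factors[OF cop] unfolding e by simp_all
    \<comment> \<open>For odd \<open>r\<close> and \<open>s\<close> this form is 3 modulo 8, so it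
      must be the factor containing \<open>p\<close>. The other factors then give
      \<open>t ^ 4 + u ^ 4 = 2 * v ^ 2\<close>, whose trivial solution survives.\<close>
    have no_square: False if "r ^ 2 + 2 * s ^ 2 = x ^ 2" for x
    proof -
      have "(r ^ 2 + 2 * s ^ 2) mod 8 = (1 + 2 * 1) mod 8"
        using odd_square_mod_8 True s by (intro mod_add_cong mod_mult_cong) simp_all
      moreover have "odd (x ^ 2)" unfolding that[symmetric] using True by simp
      ultimately show False using odd_square_mod_8[of x] that by simp
    qed
    from assms(1) show ?thesis
    proof (rule four_coprime_mult_eq_prime_power_times_power
        [OF _ _ _ _ _ _ coprime_factors(1)[OF cop] cop'(1) coprime_factors(3)[OF cop] cop'(2)
          coprime_factors(5)[OF cop] cop'(3) eq'])
      fix t u v x assume *: "r = t ^ 2" "s = u ^ 2" "e = v ^ 2" "r ^ 2 + 2 * s ^ 2 = p ^ 1 * x ^ 2"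
      then have "t ^ 4 + u ^ 4 = 2 * v ^ 2" using e by simp
      moreover have "t > 0" "u > 0" using * assms by simp_all
      ultimately have "t = u" using fourth_powers_sum_eq_twice_square by blast
      then have rs: "r = 1" "s = 1" using * assms(5) by simp_all
      then have "p * x ^ 2 = 3" using * by simp
      then have "p dvd 3" by (metis dvd_triv_left)
      then have "p = 3" using assms(1) by (simp add: primes_dvd_imp_eq)
      then show ?thesis using rs by simp
    qed ((use assms \<open>e > 0\<close> in \<open>simp; fail\<close>) | (use no_square in blast))+
  next
    case False
    then obtain e where e: "s = 2 * e" by (auto elim: evenE)
    have "e > 0" using e assms by simp
    have "2 ^ 2 * (p * (r * e * (r ^ 2 + s ^ 2) * (r ^ 2 + 2 * s ^ 2)))
        = 2 * p * (r * (2 * e) * (r ^ 2 + s ^ 2) * (r ^ 2 + 2 * s ^ 2))"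
      by simp
    also have "\<dots> = m ^ 2" using eq unfolding e[symmetric] .
    finally obtain m' where m': "p * (r * e * (r ^ 2 + s ^ 2) * (r ^ 2 + 2 * s ^ 2)) = m' ^ 2"
      by (rule square_mult_eq_square) simp
    from assms(1) m' obtain w where "r * e * (r ^ 2 + s ^ 2) * (r ^ 2 + 2 * s ^ 2) = p * w ^ 2"
      by (rule prime_mult_eq_square)
    then have eq': "r * e * (r ^ 2 + s ^ 2) * (r ^ 2 + 2 * s ^ 2) = p ^ 1 * w ^ 2" by simp
    have "e dvd s ^ 2" unfolding e by (simp add: power2_eq_square)
    then have cop: "coprime (r ^ 2) (s ^ 2)" "odd (r ^ 2)" "r dvd r ^ 2" "e dvd s ^ 2"
      using True assms by (simp_all add: dvd_power)
    from assms(1) show ?thesis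
    proof (rule four_coprime_mult_eq_prime_power_times_power
        [OF _ _ _ _ _ _ coprime_factors[OF cop] eq'])
      fix t u v x assume *: "r ^ 2 + s ^ 2 = v ^ 2" "r ^ 2 + 2 * s ^ 2 = x ^ 2"
      then show ?thesis using no_progression_with_square_difference assms by blast
    next
      fix t u v x assume *: "r ^ 2 + s ^ 2 = v ^ 2" "r ^ 2 + 2 * s ^ 2 = x ^ 2"
      then show ?thesis using no_progression_with_square_difference assms by blast
    next
      fix t u v x assume *: "r ^ 2 + s ^ 2 = p ^ 1 * v ^ 2"
      then have "r ^ 2 + 4 * e ^ 2 = p * v ^ 2" unfolding e by (simp add: power_mult_distrib)
      then show ?thesis using odd_square_neq_three_mod_four_mult_square True assms(2) by blast
    next
      fix t u v x assume *: "r = t ^ 2" "e = u ^ 2" "r ^ 2 + s ^ 2 = v ^ 2"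
      then have "t ^ 4 + 4 * u ^ 4 = v ^ 2" using e by (simp add: power_mult_distrib)
      moreover have "t > 0" "u > 0" using * assms \<open>e > 0\<close> by simp_all
      ultimately show ?thesis using fourth_power_plus_four_fourth_power_not_square by blast
    qed (use assms \<open>e > 0\<close> in simp_all)
  qed
next
  case False
  then obtain f where f: "r = 2 * f" by (auto elim: evenE)
  have "odd s" using False assms(5) by auto
  have "2 ^ 2 * (2 * p * (s * f * (s ^ 2 + 2 * f ^ 2) * (s ^ 2 + 4 * f ^ 2))) = m ^ 2"
    using eq unfolding f by (simp add: algebra_simps power2_eq_square)
  then obtain m' where m': "2 * p * (s * f * (s ^ 2 + 2 * f ^ 2) * (s ^ 2 + 4 * f ^ 2)) = m' ^ 2"
    by (rule square_mult_eq_square) simp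
  then have "2 * (p * (s * f * (s ^ 2 + 2 * f ^ 2) * (s ^ 2 + 4 * f ^ 2))) = m' ^ 2"
    by (simp add: mult_ac)
  with two_is_prime_nat obtain w' where w': "p * (s * f * (s ^ 2 + 2 * f ^ 2) * (s ^ 2 + 4 * f ^ 2)) = 2 * w' ^ 2"
    by (rule prime_mult_eq_square)
  have "odd p" using assms(2) by presburger
  \<comment> \<open>Besides \<open>f\<close>, all factors on the left are odd, while the right side
    is even.\<close>
  then have "even f" using arg_cong[OF w', of even] \<open>odd s\<close> by simp
  then obtain e where e: "f = 2 * e" by (elim evenE)
  have "e > 0" using e f assms by simp
  have w'': "p * (s * e * (s ^ 2 + 8 * e ^ 2) * (s ^ 2 + 2 * (8 * e ^ 2))) = w' ^ 2"
    using w' unfolding e by (simp add: power_mult_distrib)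
  from assms(1) w'' obtain w where "s * e * (s ^ 2 + 8 * e ^ 2) * (s ^ 2 + 2 * (8 * e ^ 2)) = p * w ^ 2"
    by (rule prime_mult_eq_square)
  then have eq': "s * e * (s ^ 2 + 8 * e ^ 2) * (s ^ 2 + 2 * (8 * e ^ 2)) = p ^ 1 * w ^ 2" by simp
  have "coprime s 8" using \<open>odd s\<close> coprime_power_right_iff[of s 2 3] by (simp add: coprime_right_2_iff_odd)
  then have cop: "coprime (s ^ 2) (8 * e ^ 2)" "odd (s ^ 2)" "s dvd s ^ 2" "e dvd 8 * e ^ 2"
    using \<open>odd s\<close> assms(5) unfolding e f
    by (simp_all add: dvd_power coprime_commute)
  from assms(1) show ?thesis
  proof (rule four_coprime_mult_eq_prime_power_times_power
      [OF _ _ _ _ _ _ coprime_factors[OF cop] eq'])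
    fix t u v x assume *: "s ^ 2 + 8 * e ^ 2 = v ^ 2" "s ^ 2 + 2 * (8 * e ^ 2) = x ^ 2"
    then show ?thesis using no_progression_with_twice_square_difference[of "2 * e" s x v] assms \<open>e > 0\<close>
      by (simp add: power_mult_distrib)
  next
    fix t u v x assume *: "s ^ 2 + 8 * e ^ 2 = v ^ 2" "s ^ 2 + 2 * (8 * e ^ 2) = x ^ 2"
    then show ?thesis using no_progression_with_twice_square_difference[of "2 * e" s x v] assms \<open>e > 0\<close>
      by (simp add: power_mult_distrib)
  next
    fix t u v x assume *: "s = t ^ 2" "e = u ^ 2" "s ^ 2 + 2 * (8 * e ^ 2) = x ^ 2"
    then have "t ^ 4 + (2 * u) ^ 4 = x ^ 2" by (simp add: power_mult_distrib)
    moreover have "t > 0" "2 * u > 0" using * assms \<open>e > 0\<close> by simp_all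
    ultimately show ?thesis using fourth_powers_sum_not_square by blast
  next
    fix t u v x assume *: "s ^ 2 + 2 * (8 * e ^ 2) = p ^ 1 * x ^ 2"
    then have "s ^ 2 + 4 * (4 * e ^ 2) = p * x ^ 2" by simp
    then show ?thesis using odd_square_neq_three_mod_four_mult_square \<open>odd s\<close> assms(2) by blast
  qed (use assms \<open>e > 0\<close> in simp_all)
qed

text \<open>A common treatment of the coefficient pairs \<open>M = 1\<close>, \<open>N = q\<close>
  and \<open>M = q\<close>, \<open>N = 1\<close> with \<open>q\<close> congruent to 5 modulo 8,
  which explains the condition on \<open>M + N\<close>. The 2-adic valuation of \<open>r\<close>
  decides: valuation 0 gives the first alternative, valuation 1 is impossible, and a higher one
  gives the second.\<close>

lemma quadratic_factors_squares:
  fixes M N r s m :: nat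
  assumes "odd M" "odd N" "(M + N) mod 8 = 6" "coprime (M * r) (N * s)" "r > 0" "s > 0"
    and eq: "r * s * (M * r ^ 2 + 4 * N * s ^ 2) * (M * r ^ 2 + 8 * N * s ^ 2) = m ^ 2"
  obtains (odd) a b A B where "r = a ^ 2" "s = b ^ 2" "odd a"
      "M * a ^ 4 + 4 * N * b ^ 4 = A ^ 2" "M * a ^ 4 + 8 * N * b ^ 4 = B ^ 2"
    | (even) a b A B where "r = 8 * a ^ 2" "s = b ^ 2" "odd b"
      "N * b ^ 4 + 8 * M * a ^ 4 = A ^ 2" "N * b ^ 4 + 16 * M * a ^ 4 = B ^ 2"
proof -
  have "M > 0" "N > 0" using assms(1,2) by (auto intro: Nat.gr0I)
  have cop: "coprime M N" "coprime M s" "coprime r N" "coprime r s" using assms(4) by simp_all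
  show ?thesis
  proof (cases "odd r")
    case True
    have eq': "r * s * (M * r ^ 2 + 4 * N * s ^ 2) * (M * r ^ 2 + 2 * (4 * N * s ^ 2)) = m ^ 2"
      using eq by (simp add: mult.assoc)
    have c: "coprime (M * r ^ 2) (4 * N * s ^ 2)" "odd (M * r ^ 2)" "r dvd M * r ^ 2"
        "s dvd 4 * N * s ^ 2"
      using True assms(1) cop by (simp_all add: coprime_4_iff_odd)
    obtain t u v x where *: "r = t ^ 2" "s = u ^ 2" "M * r ^ 2 + 4 * N * s ^ 2 = v ^ 2"
        "M * r ^ 2 + 2 * (4 * N * s ^ 2) = x ^ 2"
      by (rule four_coprime_mult_eq_power[OF _ _ _ _ _ coprime_factors[OF c] eq'])
        (use assms \<open>M > 0\<close> in simp_all)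
    then have "M * t ^ 4 + 4 * N * u ^ 4 = v ^ 2" "M * t ^ 4 + 8 * N * u ^ 4 = x ^ 2" "odd t"
      using True by simp_all
    with * odd show ?thesis by blast
  next
    case False
    then obtain f where f: "r = 2 * f" by (auto elim: evenE)
    have "odd s" using cop(4) False by auto
    have "f > 0" using f assms by simp
    show ?thesis
    proof (cases "odd f")
      case True
      have "even (M * f ^ 2 + N * s ^ 2)" using True \<open>odd s\<close> assms(1,2) by simp
      then obtain k where k: "M * f ^ 2 + N * s ^ 2 = 2 * k" by (elim evenE)
      have "k > 0" using k \<open>f > 0\<close> \<open>M > 0\<close> by (intro Nat.gr0I) simp
      have "r * s * (M * r ^ 2 + 4 * N * s ^ 2) * (M * r ^ 2 + 8 * N * s ^ 2)
          = 2 * f * s * (4 * (M * f ^ 2 + N * s ^ 2)) * (4 * (M * f ^ 2 + 2 * (N * s ^ 2)))"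
        unfolding f by (simp add: power_mult_distrib algebra_simps)
      also have "\<dots> = 8 ^ 2 * (f * s * k * (M * f ^ 2 + 2 * (N * s ^ 2)))"
        unfolding k by simp
      finally have "8 ^ 2 * (f * s * k * (M * f ^ 2 + 2 * (N * s ^ 2))) = m ^ 2" using eq by simp
      then obtain w where eq': "f * s * k * (M * f ^ 2 + 2 * (N * s ^ 2)) = w ^ 2"
        by (rule square_mult_eq_square) simp
      have c: "coprime (M * f ^ 2) (N * s ^ 2)" "odd (M * f ^ 2)" "f dvd M * f ^ 2" "s dvd N * s ^ 2"
        using True assms(1) cop f by simp_all
      have c': "coprime f k" "coprime s k" "coprime k (M * f ^ 2 + 2 * (N * s ^ 2))"
        using coprime_factors[OF c] unfolding k by simp_all
      obtain v where v: "k = v ^ 2"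
        by (rule four_coprime_mult_eq_power[OF _ _ _ _ _ coprime_factors(1)[OF c] c'(1)
          coprime_factors(3)[OF c] c'(2) coprime_factors(5)[OF c] c'(3) eq'])
        (use assms \<open>M > 0\<close> \<open>f > 0\<close> \<open>k > 0\<close> in simp_all)
      \<comment> \<open>The sum \<open>2 * k\<close> is 6 modulo 8, so \<open>k\<close> is odd; but
        an odd square \<open>k\<close> gives \<open>2 * k\<close> congruent to 2.\<close>
      have "(M * f ^ 2 + N * s ^ 2) mod 8 = (M * 1 + N * 1) mod 8"
        using odd_square_mod_8 True \<open>odd s\<close> by (intro mod_add_cong mod_mult_cong) simp_all
      then have k8: "2 * k mod 8 = 6" using assms(3) k by simp
      then have "odd k" by presburger
      then have "odd v" using v by simp
      then have "k mod 8 = 1" using odd_square_mod_8 v by blast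
      then show ?thesis using k8 by presburger
    next
      case False
      then obtain e where e: "f = 2 * e" by (auto elim: evenE)
      have "e > 0" using e \<open>f > 0\<close> by simp
      have "r * s * (M * r ^ 2 + 4 * N * s ^ 2) * (M * r ^ 2 + 8 * N * s ^ 2)
          = 8 ^ 2 * (s * f * (N * s ^ 2 + 2 * M * e ^ 2) * (N * s ^ 2 + 2 * (2 * M * e ^ 2)))"
        unfolding f e by (simp add: power_mult_distrib algebra_simps)
      then have "8 ^ 2 * (s * f * (N * s ^ 2 + 2 * M * e ^ 2) * (N * s ^ 2 + 2 * (2 * M * e ^ 2))) = m ^ 2"
        using eq by simp
      then obtain w where eq': "s * f * (N * s ^ 2 + 2 * M * e ^ 2) * (N * s ^ 2 + 2 * (2 * M * e ^ 2)) = w ^ 2"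
        by (rule square_mult_eq_square) simp
      have c: "coprime (N * s ^ 2) (2 * M * e ^ 2)" "odd (N * s ^ 2)" "s dvd N * s ^ 2"
          "f dvd 2 * M * e ^ 2"
        using \<open>odd s\<close> assms(2) cop unfolding f e
        by (simp_all add: coprime_commute coprime_left_2_iff_odd power2_eq_square)
      obtain t u v x where *: "s = t ^ 2" "f = u ^ 2" "N * s ^ 2 + 2 * M * e ^ 2 = v ^ 2"
          "N * s ^ 2 + 2 * (2 * M * e ^ 2) = x ^ 2"
        by (rule four_coprime_mult_eq_power[OF _ _ _ _ _ coprime_factors[OF c] eq'])
          (use assms \<open>N > 0\<close> \<open>f > 0\<close> in simp_all)
      \<comment> \<open>The factor \<open>f\<close> was kept whole, so it is an even square:
        \<open>f = 4 * a ^ 2\<close> and \<open>r = 8 * a ^ 2\<close>.\<close>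
      have "even u" using *(2) e by (metis dvd_triv_left even_power)
      then obtain a where a: "u = 2 * a" by (elim evenE)
      have ea: "e = 2 * a ^ 2" using *(2) e a by (simp add: power_mult_distrib)
      have "r = 8 * a ^ 2" using f e ea by simp
      moreover have "odd t" using *(1) \<open>odd s\<close> by simp
      moreover have "N * t ^ 4 + 8 * M * a ^ 4 = v ^ 2" "N * t ^ 4 + 16 * M * a ^ 4 = x ^ 2"
        using *(3,4) unfolding *(1) ea by (simp_all add: power_mult_distrib)
      ultimately show ?thesis using *(1) even by blast
    qed
  qed
qed

lemma five_mod_eight_times_fourth_power_not_square:
  fixes q a k A :: nat
  assumes "q mod 8 = 5" "odd a"
  shows "q * a ^ 4 + 8 * k \<noteq> A ^ 2"
proof
  assume eq: "q * a ^ 4 + 8 * k = A ^ 2"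
  have "q * a ^ 4 mod 8 = 5 * 1 mod 8"
    using assms odd_fourth_power_mod_8 by (intro mod_mult_cong) simp_all
  then have A: "A ^ 2 mod 8 = 5" unfolding eq[symmetric] by simp
  have "odd n" if "n mod 8 = 5" for n :: nat using that by presburger
  from this[OF A] have "odd A" by simp
  then show False using odd_square_mod_8[of A] A by simp
qed

text \<open>For even \<open>r\<close> the equation fails modulo 8. For odd \<open>r\<close> the
  squares \<open>a ^ 4\<close>, \<open>A ^ 2\<close>, \<open>B ^ 2\<close> are in progression with
  difference \<open>4 * q * b ^ 4\<close>, so the progression product would be
  \<open>p ^ j * b ^ 4\<close>.\<close>

lemma prime_power_constant_form_not_square:
  fixes p q r s m :: nat
  assumes "prime p" "q = p ^ j" "q mod 8 = 5" "coprime r s" "\<not> p dvd r" "r > 0" "s > 0"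
  shows "r * s * (r ^ 2 + 4 * q * s ^ 2) * (r ^ 2 + 8 * q * s ^ 2) \<noteq> m ^ 2"
proof
  assume "r * s * (r ^ 2 + 4 * q * s ^ 2) * (r ^ 2 + 8 * q * s ^ 2) = m ^ 2"
  then have eq: "r * s * (1 * r ^ 2 + 4 * q * s ^ 2) * (1 * r ^ 2 + 8 * q * s ^ 2) = m ^ 2" by simp
  have "coprime p r" using assms(1,5) by (simp add: prime_imp_coprime)
  then have rq: "coprime r q" unfolding assms(2) by (simp add: coprime_commute)
  then have cop: "coprime (1 * r) (q * s)" using assms(4) by simp
  have "odd q" using assms(3) by presburger
  have "(1 + q) mod 8 = 6" using assms(3) by presburger
  show False
  proof (rule quadratic_factors_squares[OF _ \<open>odd q\<close> \<open>(1 + q) mod 8 = 6\<close> cop assms(6,7) eq])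
    fix a b A B
    assume *: "r = a ^ 2" "s = b ^ 2" "odd a" "1 * a ^ 4 + 4 * q * b ^ 4 = A ^ 2"
      "1 * a ^ 4 + 8 * q * b ^ 4 = B ^ 2"
    have D: "4 * (q * b ^ 4) > 0" using * assms by (simp add: prime_gt_0_nat)
    have "coprime (a ^ 2) (4 * (q * b ^ 4))"
      using rq assms(4) * by (simp add: coprime_4_iff_odd)
    moreover have "odd (a ^ 2)" using * by simp
    moreover have "(a ^ 2) ^ 2 + 4 * (q * b ^ 4) = A ^ 2"
      "(a ^ 2) ^ 2 + 2 * (4 * (q * b ^ 4)) = B ^ 2" using * by simp_all
    ultimately obtain u v where uv: "u > 0" "v > 0" "odd v" "coprime u v"
        "4 * (q * b ^ 4) = 4 * (u * v * (u + v) * (2 * u + v))"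
      using D squares_in_arithmetic_progression by metis
    then show False
      using progression_product_neq_prime_power_times_fourth_power[OF assms(1) uv(1-4), of j b]
        assms(2) by simp
  next
    fix a b A B
    assume *: "odd b" "q * b ^ 4 + 8 * 1 * a ^ 4 = A ^ 2"
    then show False using five_mod_eight_times_fourth_power_not_square[OF assms(3), of b "a ^ 4" A] by simp
  qed simp
qed

text \<open>Now odd \<open>r\<close> fails modulo 8, and even \<open>r\<close> gives a progression
  starting at \<open>b ^ 4\<close> with difference \<open>8 * q * a ^ 4\<close>; its product would
  be \<open>2 * (p ^ j * a ^ 4)\<close>.\<close>

lemma prime_power_leading_form_not_square:
  fixes p q r s m :: nat
  assumes "prime p" "p \<noteq> 3" "q = p ^ j" "q mod 8 = 5" "coprime r s" "\<not> p dvd s" "r > 0" "s > 0"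
  shows "r * s * (q * r ^ 2 + 4 * s ^ 2) * (q * r ^ 2 + 8 * s ^ 2) \<noteq> m ^ 2"
proof
  assume "r * s * (q * r ^ 2 + 4 * s ^ 2) * (q * r ^ 2 + 8 * s ^ 2) = m ^ 2"
  then have eq: "r * s * (q * r ^ 2 + 4 * 1 * s ^ 2) * (q * r ^ 2 + 8 * 1 * s ^ 2) = m ^ 2" by simp
  have "coprime p s" using assms(1,6) by (simp add: prime_imp_coprime)
  then have sq: "coprime s q" unfolding assms(3) by (simp add: coprime_commute)
  then have cop: "coprime (q * r) (1 * s)" using assms(5) by (simp add: coprime_commute)
  have "odd q" using assms(4) by presburger
  have "(q + 1) mod 8 = 6" using assms(4) by presburger
  from \<open>odd q\<close> show False
  proof (rule quadratic_factors_squares[OF _ _ \<open>(q + 1) mod 8 = 6\<close> cop assms(7,8) eq])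
    fix a b A B
    assume *: "odd a" "q * a ^ 4 + 8 * 1 * b ^ 4 = B ^ 2"
    then show False using five_mod_eight_times_fourth_power_not_square[OF assms(4), of a "b ^ 4" B] by simp
  next
    fix a b A B
    assume *: "r = 8 * a ^ 2" "s = b ^ 2" "odd b" "1 * b ^ 4 + 8 * q * a ^ 4 = A ^ 2"
      "1 * b ^ 4 + 16 * q * a ^ 4 = B ^ 2"
    have D: "8 * (q * a ^ 4) > 0" using * assms by (simp add: prime_gt_0_nat)
    have "coprime b 8" using * coprime_power_right_iff[of b 2 3] by (simp add: coprime_right_2_iff_odd)
    then have "coprime (b ^ 2) (8 * (q * a ^ 4))"
      using sq assms(5) * by (simp add: coprime_commute)
    moreover have "odd (b ^ 2)" using * by simp
    moreover have "(b ^ 2) ^ 2 + 8 * (q * a ^ 4) = A ^ 2"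
      "(b ^ 2) ^ 2 + 2 * (8 * (q * a ^ 4)) = B ^ 2" using * by simp_all
    ultimately obtain u v where uv: "u > 0" "v > 0" "odd v" "coprime u v"
        "8 * (q * a ^ 4) = 4 * (u * v * (u + v) * (2 * u + v))"
      using D squares_in_arithmetic_progression by metis
    then show False
      using progression_product_neq_twice_prime_power_times_fourth_power[OF assms(1,2) uv(1-4), of j a]
        assms(3) by simp
  qed simp
qed

text \<open>A square divisible by \<open>p\<close> contains \<open>p\<close> twice, so
  \<open>p\<close> divides one of the four factors. Modulo \<open>p\<close> both forms reduce to a
  power of 2 times \<open>s ^ 2\<close>, which leaves only \<open>r\<close>.\<close>

lemma prime_dvd_of_mult_eq_square:
  fixes p r s u m :: nat
  assumes "prime p" "odd p" "\<not> p dvd s" "p dvd u"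
    "p * (r * s * (u + 4 * s ^ 2) * (u + 8 * s ^ 2)) = m ^ 2"
  shows "p dvd r"
proof -
  obtain w where "r * s * (u + 4 * s ^ 2) * (u + 8 * s ^ 2) = p * w ^ 2"
    using prime_mult_eq_square[OF assms(1,5)] .
  then have "p dvd r * s * (u + 4 * s ^ 2) * (u + 8 * s ^ 2)" by simp
  moreover have "\<not> p dvd 2 ^ k * s ^ 2" for k
    using assms(1-3) by (metis even_numeral prime_dvd_mult_iff prime_dvd_power
        primes_dvd_imp_eq two_is_prime_nat dvd_refl)
  from this[of 2] this[of 3] have "\<not> p dvd u + 4 * s ^ 2" "\<not> p dvd u + 8 * s ^ 2"
    using assms(4) by (simp_all add: dvd_add_right_iff)
  ultimately show ?thesis using assms(1,3) by (auto simp: prime_dvd_mult_iff)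
qed

text \<open>
  If \<open>p\<close> divides \<open>r\<close>, it does so at least twice; dividing out \<open>p\<^sup>2\<close> moves the prime power to the
  leading coefficient and exchanges \<open>p\<close> with \<open>p\<^sup>3\<close>.
\<close>

lemma prime_form_not_square:
  fixes p r s m :: nat
  assumes "prime p" "p mod 8 = 5" "coprime r s" "r > 0" "s > 0"
  shows "r * s * (r ^ 2 + 4 * p * s ^ 2) * (r ^ 2 + 8 * p * s ^ 2) \<noteq> m ^ 2"
proof
  assume eq: "r * s * (r ^ 2 + 4 * p * s ^ 2) * (r ^ 2 + 8 * p * s ^ 2) = m ^ 2"
  have "odd p" using assms(2) by presburger
  have "p \<noteq> 3" using assms(2) by auto
  show False
  proof (cases "p dvd r")
    case False
    then show False
      using prime_power_constant_form_not_square[of p p 1 r s m] assms eq by simp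
  next
    case True
    then obtain r' where r': "r = p * r'" ..
    have ps: "\<not> p dvd s" using True assms(1,3) by (meson coprime_common_divisor not_prime_unit)
    have "p ^ 2 * (p * (r' * s * (p * r' ^ 2 + 4 * s ^ 2) * (p * r' ^ 2 + 8 * s ^ 2))) = m ^ 2"
      using eq unfolding r' by (simp add: power2_eq_square algebra_simps)
    then obtain w where w: "p * (r' * s * (p * r' ^ 2 + 4 * s ^ 2) * (p * r' ^ 2 + 8 * s ^ 2)) = w ^ 2"
      by (rule square_mult_eq_square) (use assms(1) in \<open>simp add: prime_gt_0_nat\<close>)
    have "p dvd r'"
      by (rule prime_dvd_of_mult_eq_square[OF assms(1) \<open>odd p\<close> ps _ w]) simp
    then obtain t where t: "r' = p * t" ..
    have "p ^ 2 * (t * s * (p ^ 3 * t ^ 2 + 4 * s ^ 2) * (p ^ 3 * t ^ 2 + 8 * s ^ 2)) = w ^ 2"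
      using w unfolding t by (simp add: power2_eq_square power3_eq_cube algebra_simps)
    then obtain v where v: "t * s * (p ^ 3 * t ^ 2 + 4 * s ^ 2) * (p ^ 3 * t ^ 2 + 8 * s ^ 2) = v ^ 2"
      by (rule square_mult_eq_square) (use assms(1) in \<open>simp add: prime_gt_0_nat\<close>)
    \<comment> \<open>The cube of 5 is 125, again 5 modulo 8.\<close>
    have "p ^ 3 mod 8 = 5" using power_mod[of p 8 3] assms(2) by simp
    then show False
      using prime_power_leading_form_not_square[OF assms(1) \<open>p \<noteq> 3\<close> refl _ _ ps, of 3 t v] v assms(3-5)
      unfolding r' t by simp
  qed
qed

text \<open>If \<open>p\<close> divides \<open>r\<close>, the first division lowers
  \<open>p ^ 3\<close> to \<open>p\<close> in the constant terms, and the second moves this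
  \<open>p\<close> to the leading coefficient.\<close>

lemma prime_cube_form_not_square:
  fixes p r s m :: nat
  assumes "prime p" "p mod 8 = 5" "coprime r s" "r > 0" "s > 0"
  shows "r * s * (r ^ 2 + 4 * p ^ 3 * s ^ 2) * (r ^ 2 + 8 * p ^ 3 * s ^ 2) \<noteq> m ^ 2"
proof
  assume eq: "r * s * (r ^ 2 + 4 * p ^ 3 * s ^ 2) * (r ^ 2 + 8 * p ^ 3 * s ^ 2) = m ^ 2"
  have "odd p" using assms(2) by presburger
  have "p \<noteq> 3" using assms(2) by auto
  show False
  proof (cases "p dvd r")
    case False
    have "p ^ 3 mod 8 = 5" using power_mod[of p 8 3] assms(2) by simp
    then show False
      using prime_power_constant_form_not_square[of p "p ^ 3" 3 r s m] assms False eq by simp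
  next
    case True
    then obtain r' where r': "r = p * r'" ..
    have ps: "\<not> p dvd s" using True assms(1,3) by (meson coprime_common_divisor not_prime_unit)
    have "(p ^ 2) ^ 2 * (p * (r' * s * (r' ^ 2 + 4 * p * s ^ 2) * (r' ^ 2 + 8 * p * s ^ 2))) = m ^ 2"
      using eq unfolding r' by (simp add: power2_eq_square power3_eq_cube algebra_simps)
    then obtain w where w: "p * (r' * s * (r' ^ 2 + 4 * p * s ^ 2) * (r' ^ 2 + 8 * p * s ^ 2)) = w ^ 2"
      by (rule square_mult_eq_square) (use assms(1) in \<open>simp add: prime_gt_0_nat\<close>)
    have "p dvd r'"
    proof -
      obtain v where "r' * s * (r' ^ 2 + 4 * p * s ^ 2) * (r' ^ 2 + 8 * p * s ^ 2) = p * v ^ 2"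
        using prime_mult_eq_square[OF assms(1) w] .
      then have "p dvd r' * s * (r' ^ 2 + 4 * p * s ^ 2) * (r' ^ 2 + 8 * p * s ^ 2)" by simp
      \<comment> \<open>The constant terms are still multiples of \<open>p\<close>, so
        \<open>p\<close> dividing a quadratic factor also implies that it divides
        \<open>r'\<close>.\<close>
      moreover have "p dvd r'" if "p dvd r' ^ 2 + k * p * s ^ 2" for k
      proof -
        have "p dvd r' ^ 2" using that by (simp add: dvd_add_left_iff)
        then show ?thesis using assms(1) prime_dvd_power by blast
      qed
      ultimately show ?thesis using assms(1) ps by (metis prime_dvd_mult_iff)
    qed
    then obtain t where t: "r' = p * t" ..
    have "(p ^ 2) ^ 2 * (t * s * (p * t ^ 2 + 4 * s ^ 2) * (p * t ^ 2 + 8 * s ^ 2)) = w ^ 2"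
      using w unfolding t by (simp add: power2_eq_square algebra_simps)
    then obtain v where v: "t * s * (p * t ^ 2 + 4 * s ^ 2) * (p * t ^ 2 + 8 * s ^ 2) = v ^ 2"
      by (rule square_mult_eq_square) (use assms(1) in \<open>simp add: prime_gt_0_nat\<close>)
    then show False
      using prime_power_leading_form_not_square[OF assms(1) \<open>p \<noteq> 3\<close> _ assms(2) _ ps, of 1 t v] assms(3-5)
      unfolding r' t by simp
  qed
qed

section \<open>Rational points\<close>

text \<open>In lowest terms the denominator of \<open>y\<close> divides the square of its numerator,
  hence is 1.\<close>

lemma rat_square_eq_of_nat:
  fixes y :: rat
  assumes "y ^ 2 = of_nat n"
  obtains m where "n = m ^ 2"
proof -
  obtain a b where ab: "quotient_of y = (a, b)" by (cases "quotient_of y")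
  then have b: "b > 0" "coprime a b" "y = of_int a / of_int b"
    by (simp_all add: quotient_of_denom_pos quotient_of_coprime quotient_of_div)
  have "(of_int (a ^ 2) :: rat) = of_int (int n * b ^ 2)"
    using assms b by (simp add: power_divide field_simps)
  then have eq: "a ^ 2 = int n * b ^ 2" by (simp only: of_int_eq_iff)
  then have "b dvd a ^ 2" by (simp add: power2_eq_square)
  moreover have "coprime b (a ^ 2)" using b(2) by (simp add: coprime_commute)
  ultimately have "is_unit b" by (metis coprime_absorb_left)
  then have "b = 1" using b(1) by simp
  then have "int n = int (nat \<bar>a\<bar>) ^ 2" using eq by simp
  then have "n = nat \<bar>a\<bar> ^ 2" by (metis of_nat_eq_iff of_nat_power)
  then show ?thesis by (rule that)
qed

lemma pos_rat_quotient:
  fixes x :: rat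
  assumes "x > 0"
  obtains r s :: nat where "x = of_nat r / of_nat s" "r > 0" "s > 0" "coprime r s"
proof -
  obtain a b where ab: "quotient_of x = (a, b)" by (cases "quotient_of x")
  then have b: "b > 0" "coprime a b" "x = of_int a / of_int b"
    by (simp_all add: quotient_of_denom_pos quotient_of_coprime quotient_of_div)
  then have "a > 0" using assms by (simp add: zero_less_divide_iff)
  with b have "x = of_nat (nat a) / of_nat (nat b)" "coprime (nat a) (nat b)"
    by (simp_all add: coprime_int_iff[symmetric] del: coprime_int_iff)
  with that[of "nat a" "nat b"] \<open>a > 0\<close> b(1) show ?thesis by simp
qed

text \<open>Both quadratic factors are positive and the product is a square, so \<open>x\<close>
  cannot be negative.\<close>

lemma curve_point_x_pos:
  fixes x y a b :: "'a :: linordered_field"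
  assumes "y ^ 2 = x * (x ^ 2 + a) * (x ^ 2 + b)" "a > 0" "b > 0" "x \<noteq> 0"
  shows "x > 0"
proof -
  have "0 < (x ^ 2 + a) * (x ^ 2 + b)" using assms by (simp add: add_nonneg_pos)
  moreover have "0 \<le> x * ((x ^ 2 + a) * (x ^ 2 + b))"
    using assms(1) by (metis mult.assoc zero_le_power2)
  ultimately show ?thesis using assms(4) by (simp add: zero_le_mult_iff)
qed

text \<open>Used with \<open>c = p\<close> and \<open>c = 2 * p\<close>: the substitution of
  \<open>c * r / s\<close> for \<open>x\<close> makes the quadratic forms independent of
  \<open>c\<close>.\<close>

lemma curve_point_scaled_form:
  fixes x y :: rat and c :: nat
  assumes "y ^ 2 = x * (x ^ 2 + of_nat c ^ 2) * (x ^ 2 + 2 * of_nat c ^ 2)" "c > 0" "x \<noteq> 0"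
  obtains r s m where "r > 0" "s > 0" "coprime r s" "x = of_nat c * of_nat r / of_nat s"
    "c * (r * s * (r ^ 2 + s ^ 2) * (r ^ 2 + 2 * s ^ 2)) = m ^ 2"
proof -
  have "x > 0" by (rule curve_point_x_pos[OF assms(1) _ _ assms(3)]) (use assms(2) in simp_all)
  then have "x / of_nat c > 0" using assms(2) by simp
  then obtain r s :: nat where rs: "x / of_nat c = of_nat r / of_nat s" "r > 0" "s > 0" "coprime r s"
    by (rule pos_rat_quotient)
  define C R S :: rat where "C = of_nat c" and "R = of_nat r" and "S = of_nat s"
  have nz: "C \<noteq> 0" "S \<noteq> 0" using assms(2) rs(3) by (simp_all add: C_def S_def)
  have x: "x = C * R / S" using rs(1) nz unfolding C_def R_def S_def by (simp add: field_simps)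
  \<comment> \<open>The right side is homogeneous of weight 5 in \<open>C\<close>, and dividing by
    \<open>C ^ 4\<close> leaves one \<open>C\<close>; the factor \<open>S ^ 6\<close> clears the
    denominator \<open>S ^ 5\<close> and leaves one \<open>S\<close>.\<close>
  have "(y * S ^ 3 / C ^ 2) ^ 2 = (C * R / S * ((C * R / S) ^ 2 + C ^ 2) * ((C * R / S) ^ 2 + 2 * C ^ 2)) * S ^ 6 / C ^ 4"
    using assms(1) unfolding x C_def[symmetric] by (simp add: power_mult_distrib power_divide flip: power_mult)
  also have "\<dots> = C * (R * S * (R ^ 2 + S ^ 2) * (R ^ 2 + 2 * S ^ 2))"
    using nz by (simp add: field_simps eval_nat_numeral)
  also have "\<dots> = of_nat (c * (r * s * (r ^ 2 + s ^ 2) * (r ^ 2 + 2 * s ^ 2)))"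
    by (simp add: C_def R_def S_def)
  finally obtain m where "c * (r * s * (r ^ 2 + s ^ 2) * (r ^ 2 + 2 * s ^ 2)) = m ^ 2"
    by (rule rat_square_eq_of_nat)
  then show ?thesis using that rs x unfolding C_def R_def S_def by blast
qed

lemma curve_point_form:
  fixes x y :: rat and q :: nat
  assumes "y ^ 2 = x * (x ^ 2 + 4 * of_nat q) * (x ^ 2 + 8 * of_nat q)" "q > 0" "x \<noteq> 0"
  obtains r s m where "r > 0" "s > 0" "coprime r s"
    "r * s * (r ^ 2 + 4 * q * s ^ 2) * (r ^ 2 + 8 * q * s ^ 2) = m ^ 2"
proof -
  have "x > 0" by (rule curve_point_x_pos[OF assms(1) _ _ assms(3)]) (use assms(2) in simp_all)
  then obtain r s :: nat where rs: "x = of_nat r / of_nat s" "r > 0" "s > 0" "coprime r s"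
    by (rule pos_rat_quotient)
  define Q R S :: rat where "Q = of_nat q" and "R = of_nat r" and "S = of_nat s"
  have nz: "S \<noteq> 0" using rs(3) by (simp add: S_def)
  have x: "x = R / S" using rs(1) unfolding R_def S_def .
  have "(y * S ^ 3) ^ 2 = (R / S * ((R / S) ^ 2 + 4 * Q) * ((R / S) ^ 2 + 8 * Q)) * S ^ 6"
    using assms(1) unfolding x Q_def[symmetric] by (simp add: power_mult_distrib flip: power_mult)
  also have "\<dots> = R * S * (R ^ 2 + 4 * Q * S ^ 2) * (R ^ 2 + 8 * Q * S ^ 2)"
    using nz by (simp add: field_simps eval_nat_numeral)
  also have "\<dots> = of_nat (r * s * (r ^ 2 + 4 * q * s ^ 2) * (r ^ 2 + 8 * q * s ^ 2))"
    by (simp add: Q_def R_def S_def)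
  finally obtain m where "r * s * (r ^ 2 + 4 * q * s ^ 2) * (r ^ 2 + 8 * q * s ^ 2) = m ^ 2"
    by (rule rat_square_eq_of_nat)
  then show ?thesis using that rs by blast
qed

section \<open>Determination of the point sets\<close>

lemma C_rational_points_trivial:
  assumes "\<And>x y. y ^ 2 = C_rhs p i j x \<Longrightarrow> x = 0"
  shows "C_rational_points p i j = {Affine 0 0, Infinity}"
proof -
  have "C_rhs p i j 0 = 0" by (simp add: C_rhs_def)
  moreover have "x = 0 \<and> y = 0" if "y ^ 2 = C_rhs p i j x" for x y
  proof -
    have "x = 0" using assms that by blast
    then show ?thesis using that \<open>C_rhs p i j 0 = 0\<close> by simp
  qed
  ultimately show ?thesis unfolding C_rational_points_def by force
qed

lemma twice_prime_curve_points:
  fixes x y :: rat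
  assumes "prime p" "p mod 4 = 3" "y ^ 2 = C_rhs p 2 2 x" "x \<noteq> 0"
  shows "p = 3 \<and> x = 6"
proof -
  have "y ^ 2 = x * (x ^ 2 + of_nat (2 * p) ^ 2) * (x ^ 2 + 2 * of_nat (2 * p) ^ 2)"
    using assms(3) by (simp add: C_rhs_def power_mult_distrib)
  then obtain r s m where rs: "r > 0" "s > 0" "coprime r s" "x = of_nat (2 * p) * of_nat r / of_nat s"
    "2 * p * (r * s * (r ^ 2 + s ^ 2) * (r ^ 2 + 2 * s ^ 2)) = m ^ 2"
    by (rule curve_point_scaled_form) (use assms in \<open>simp_all add: prime_gt_0_nat\<close>)
  then show ?thesis using twice_prime_times_form_eq_square[OF assms(1,2) rs(1-3,5)] by simp
qed

theorem theorem1p1: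
  fixes p :: nat
  assumes "prime p"
  shows "C_rational_points p 0 2 = {Affine 0 0, Infinity} \<and>
    ([p = 3] (mod 4) \<longrightarrow>
       C_rational_points p 2 2 =
         (if p = 3 then {Affine 0 0, Affine 6 216, Affine 6 (-216), Infinity}
          else {Affine 0 0, Infinity})) \<and>
    ([p = 13] (mod 16) \<longrightarrow> C_rational_points p 2 1 = {Affine 0 0, Infinity}) \<and>
    ([p = 5] (mod 16) \<longrightarrow> C_rational_points p 2 3 = {Affine 0 0, Infinity})"
proof (intro conjI impI)
  have "p > 0" using assms by (rule prime_gt_0_nat)
  show "C_rational_points p 0 2 = {Affine 0 0, Infinity}"
  proof (rule C_rational_points_trivial, rule ccontr)
    fix x y assume "y ^ 2 = C_rhs p 0 2 x" "x \<noteq> 0"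
    then have "y ^ 2 = x * (x ^ 2 + of_nat p ^ 2) * (x ^ 2 + 2 * of_nat p ^ 2)"
      by (simp add: C_rhs_def)
    then show False
      by (rule curve_point_scaled_form[OF _ \<open>p > 0\<close> \<open>x \<noteq> 0\<close>])
        (use prime_times_form_not_square assms in blast)
  qed
  show "C_rational_points p 2 2 =
         (if p = 3 then {Affine 0 0, Affine 6 216, Affine 6 (-216), Infinity}
          else {Affine 0 0, Infinity})" if "[p = 3] (mod 4)"
  proof (cases "p = 3")
    case False
    have "p mod 4 = 3" using that by (simp add: cong_def)
    then show ?thesis
      using twice_prime_curve_points[OF assms] False C_rational_points_trivial[of p 2 2] by auto
  next
    case True
    \<comment> \<open>The surviving case \<open>r = s = 1\<close> gives \<open>x = 6\<close>, and
      \<open>6 * 72 * 108 = 216 ^ 2\<close> determines \<open>y\<close> up to sign.\<close>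
    have "y ^ 2 = C_rhs 3 2 2 x \<longleftrightarrow> x = 0 \<and> y = 0 \<or> x = 6 \<and> (y = 216 \<or> y = -216)" for x y
    proof -
      have "C_rhs 3 2 2 0 = 0" "C_rhs 3 2 2 6 = 216 ^ 2" by (simp_all add: C_rhs_def)
      moreover have "y ^ 2 = C_rhs 3 2 2 x \<Longrightarrow> x = 0 \<or> x = 6"
        using twice_prime_curve_points[of 3 y x] assms True by auto
      moreover have "y ^ 2 = 216 ^ 2 \<longleftrightarrow> y = 216 \<or> y = -216" by (rule power2_eq_iff)
      ultimately show ?thesis by fastforce
    qed
    then show ?thesis using True unfolding C_rational_points_def by auto
  qed
  show "C_rational_points p 2 1 = {Affine 0 0, Infinity}" if "[p = 13] (mod 16)"
  proof (rule C_rational_points_trivial, rule ccontr)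
    have "p mod 16 = 13" using that by (simp add: cong_def)
    then have p8: "p mod 8 = 5" by presburger
    fix x y assume "y ^ 2 = C_rhs p 2 1 x" "x \<noteq> 0"
    then have "y ^ 2 = x * (x ^ 2 + 4 * of_nat p) * (x ^ 2 + 8 * of_nat p)"
      by (simp add: C_rhs_def)
    then show False
      by (rule curve_point_form[OF _ \<open>p > 0\<close> \<open>x \<noteq> 0\<close>])
        (use prime_form_not_square assms p8 in blast)
  qed
  show "C_rational_points p 2 3 = {Affine 0 0, Infinity}" if "[p = 5] (mod 16)"
  proof (rule C_rational_points_trivial, rule ccontr)
    have "p mod 16 = 5" using that by (simp add: cong_def)
    then have p8: "p mod 8 = 5" by presburger
    fix x y assume "y ^ 2 = C_rhs p 2 3 x" "x \<noteq> 0"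
    then have "y ^ 2 = x * (x ^ 2 + 4 * of_nat (p ^ 3)) * (x ^ 2 + 8 * of_nat (p ^ 3))"
      by (simp add: C_rhs_def)
    then show False
      by (rule curve_point_form[OF _ _ \<open>x \<noteq> 0\<close>])
        (use prime_cube_form_not_square assms p8 \<open>p > 0\<close> in \<open>simp; blast\<close>)+
  qed
qed

end
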